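(* Let $n\ge1$, let $I$ be an open interval of $\mathbb{R}$ containing $0$ and $A,B\in C^\infty(I,M_n(\mathbb{R}))$. Define $\tilde A_0(t)=A(t)$ and $\tilde A_{k+1}(t)=\frac{d}{dt}\tilde A_k(t)+B(t)\tilde A_k(t)$ for $k\ge0$, $t\in I$. Assume that for some $T>0$ with $T\in I$, $\mathrm{Span}\{\tilde A_k(T)x:\ x\in\mathbb{R}^n,\ k\ge0\}=\mathbb{R}^n$. Let $0<\varepsilon<T$ and $0<\tilde\varepsilon\le\varepsilon/2$ be an admissible pair of constants (as defined in the context). Then there exists a constant $c_0>0$ such that for all $g_0\in L^2(\mathbb{R}^n)$ the mild solution $g$ to $$\begin{cases}\partial_tg-\frac12\mathrm{Tr}\big(A(T-t)A(T-t)^T\nabla_x^2g\big)+\langle B(T-t)x,\nabla_xg\rangle+\frac12\mathrm{Tr}\big(B(T-t)\big)g=0,\\ g|_{t=0}=g_0,\end{cases}$$ on $[0,T]\times\mathbb{R}^n$ satisfies, for all $\frac\varepsilon2\le t<\tau\le\frac\varepsilon2+\tilde\varepsilon$ and all integers $k\ge0$, $$\||D_x|^kg(\tau)\|_{L^2(\mathbb{R}^n)}\le\frac{c_0^k}{(\tau-t)^{\frac{(2n-1)k}{2}}}\sqrt{k!}\,\|g(t)\|_{L^2(\mathbb{R}^n)}\le\frac{c_0^k}{(\tau-t)^{\frac{(2n-1)k}{2}}}\sqrt{k!}\,\|g_0\|_{L^2(\mathbb{R}^n)}.$$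
   Context: $M^T$ is the transpose of $M$; $|\cdot|$ is the Euclidean norm; $\langle B(T-t)x,\nabla_xg\rangle=\sum_{j=1}^n(B(T-t)x)_j\partial_{x_j}g$; $\hat h(\xi)=\int_{\mathbb{R}^n}h(x)e^{-ix\cdot\xi}dx$; $|D_x|^k$ is the Fourier multiplier with symbol $|\xi|^k$. $R:[0,T]^2\to M_n(\mathbb{R})$ is the resolvent of $\dot X(t)=B(T-t)X(t)$: $\partial_{t_1}R(t_1,t_2)=B(T-t_1)R(t_1,t_2)$, $R(t_2,t_2)=I_n$. Admissible pair: $(\varepsilon,\tilde\varepsilon)$ with $0<\varepsilon<T$, $0<\tilde\varepsilon\le\varepsilon/2$ is admissible if (a) for all $T-\varepsilon\le t\le T-\varepsilon/2$, $\mathrm{Span}\{\tilde A_k(t)x: x\in\mathbb{R}^n,\ 0\le k\le n-1\}=\mathbb{R}^n$; and (b) there is $c>0$ such that for all $\frac\varepsilon2\le t\le\tau\le\frac\varepsilon2+\tilde\varepsilon$ and all $\xi\in\mathbb{R}^n$, $\int_t^\tau|A(T-s)^TR(t,s)^T\xi|^2ds\ge c(\tau-t)^{2n-1}|\xi|^2$. (Under the span hypothesis at time $T$, admissible pairs exist.) Mild solution: the function $g\in C^0([0,T],L^2(\mathbb{R}^n))$ whose Fourier transform in $x$ is $$\hat g(t,\xi)=e^{\frac12\int_0^t\mathrm{Tr}(B(T-s))ds}\,\hat g_0\big(R(t,0)^T\xi\big)\,e^{-\frac12\int_0^t|A(T-s)^TR(t,s)^T\xi|^2ds}.$$ *)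

theory Defs
  imports "HOL-Analysis.Analysis"
begin

definition smooth_on :: "real set \<Rightarrow> (real \<Rightarrow> 'a::real_normed_vector) \<Rightarrow> bool" where
  "smooth_on I f \<longleftrightarrow>
     (\<forall>k. \<forall>t\<in>I. ((\<lambda>h s. vector_derivative h (at s)) ^^ k) f differentiable (at t))"

primrec A_tilde ::
  "(real \<Rightarrow> real^'n^'n) \<Rightarrow> (real \<Rightarrow> real^'n^'n) \<Rightarrow> nat \<Rightarrow> real \<Rightarrow> real^'n^'n" where
  "A_tilde A B 0 = A"
| "A_tilde A B (Suc k) =
     (\<lambda>t. vector_derivative (A_tilde A B k) (at t) + B t ** A_tilde A B k t)"

text \<open>Only the values of \<open>R\<close> on the square \<open>[0,T] \<times> [0,T]\<close> are constrained; there they are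
  determined uniquely by this linear Cauchy problem. At the end points of \<open>[0,T]\<close> the derivative
  is one-sided.\<close>

definition is_resolvent ::
  "(real \<Rightarrow> real^'n^'n) \<Rightarrow> real \<Rightarrow> (real \<Rightarrow> real \<Rightarrow> real^'n^'n) \<Rightarrow> bool" where
  "is_resolvent B T R \<longleftrightarrow>
     (\<forall>t\<^sub>2\<in>{0..T}. R t\<^sub>2 t\<^sub>2 = mat 1 \<and>
        (\<forall>t\<^sub>1\<in>{0..T}. ((\<lambda>t. R t t\<^sub>2) has_vector_derivative (B (T - t\<^sub>1) ** R t\<^sub>1 t\<^sub>2))
           (at t\<^sub>1 within {0..T})))"

definition admissible_pair ::
  "(real \<Rightarrow> real^'n^'n) \<Rightarrow> (real \<Rightarrow> real^'n^'n) \<Rightarrow> real \<Rightarrow>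
   (real \<Rightarrow> real \<Rightarrow> real^'n^'n) \<Rightarrow> real \<Rightarrow> real \<Rightarrow> bool" where
  "admissible_pair A B T R \<epsilon> \<epsilon>' \<longleftrightarrow>
     0 < \<epsilon> \<and> \<epsilon> < T \<and> 0 < \<epsilon>' \<and> \<epsilon>' \<le> \<epsilon> / 2 \<and>
     (\<forall>t. T - \<epsilon> \<le> t \<and> t \<le> T - \<epsilon> / 2 \<longrightarrow>
        span {A_tilde A B k t *v x | k x. k \<le> CARD('n) - 1} = UNIV) \<and>
     (\<exists>c>0. \<forall>t \<tau>. \<epsilon> / 2 \<le> t \<and> t \<le> \<tau> \<and> \<tau> \<le> \<epsilon> / 2 + \<epsilon>' \<longrightarrow>
        (\<forall>\<xi>. integral {t..\<tau>}
                (\<lambda>s. (norm (transpose (A (T - s)) *v (transpose (R t s) *v \<xi>)))\<^sup>2)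
              \<ge> c * (\<tau> - t) ^ (2 * CARD('n) - 1) * (norm \<xi>)\<^sup>2))"

text \<open>The elements of \<open>L\<^sup>2\<close> are represented by functions, so identities between them are stated
  almost everywhere.\<close>

definition L2_space :: "('a::euclidean_space \<Rightarrow> complex) set" where
  "L2_space = {f. f \<in> borel_measurable lebesgue \<and> integrable lebesgue (\<lambda>x. (cmod (f x))\<^sup>2)}"

definition L2_norm :: "('a::euclidean_space \<Rightarrow> complex) \<Rightarrow> real" where
  "L2_norm f = sqrt (LINT x|lebesgue. (cmod (f x))\<^sup>2)"

text \<open>The Fourier transform on \<open>L\<^sup>2\<close>: the limit in mean of the Fourier integrals
  of the truncations of \<open>f\<close> to balls (which are in \<open>L\<^sup>1 \<inter> L\<^sup>2\<close>). The convergence is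
  stated with the nonnegative integral, since the Bochner integral would be \<open>0\<close> for a
  difference that is not square integrable.\<close>

definition is_L2_fourier ::
  "('a::euclidean_space \<Rightarrow> complex) \<Rightarrow> ('a \<Rightarrow> complex) \<Rightarrow> bool" where
  "is_L2_fourier f F \<longleftrightarrow> F \<in> L2_space \<and>
     ((\<lambda>r::real. \<integral>\<^sup>+ \<xi>. ennreal ((cmod ((LINT x:cball 0 r|lebesgue.
           f x * exp (- (\<i> * complex_of_real (x \<bullet> \<xi>)))) - F \<xi>))\<^sup>2) \<partial>lebesgue)
        \<longlongrightarrow> 0) at_top"

text \<open>For \<open>f\<close> in \<open>L\<^sup>2\<close> the limit exists by Plancherel's theorem and is unique up to
  null sets; \<open>L2_fourier\<close> picks a representative.\<close>

definition L2_fourier :: "('a::euclidean_space \<Rightarrow> complex) \<Rightarrow> 'a \<Rightarrow> complex" where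
  "L2_fourier f = (SOME F. is_L2_fourier f F)"

text \<open>\<open>f\<close> lies in the \<open>L\<^sup>2\<close> domain of \<open>|D\<^sub>x|\<^sup>k\<close>, and \<open>h\<close> represents \<open>|D\<^sub>x|\<^sup>k f\<close>; such an
  \<open>h\<close> is unique up to null sets.\<close>

definition is_abs_D_power ::
  "nat \<Rightarrow> ('a::euclidean_space \<Rightarrow> complex) \<Rightarrow> ('a \<Rightarrow> complex) \<Rightarrow> bool" where
  "is_abs_D_power k f h \<longleftrightarrow> f \<in> L2_space \<and> h \<in> L2_space \<and>
     (AE \<xi> in lebesgue. L2_fourier h \<xi> = complex_of_real (norm \<xi> ^ k) * L2_fourier f \<xi>)"

definition continuous_into_L2 :: "real \<Rightarrow> (real \<Rightarrow> 'a::euclidean_space \<Rightarrow> complex) \<Rightarrow> bool" where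
  "continuous_into_L2 T g \<longleftrightarrow> (\<forall>t\<in>{0..T}. g t \<in> L2_space \<and>
     ((\<lambda>s. L2_norm (\<lambda>x. g s x - g t x)) \<longlongrightarrow> 0) (at t within {0..T}))"

text \<open>The mild solution of
  \<open>\<partial>\<^sub>t g - 1/2 Tr(A(T-t) A(T-t)\<^sup>T \<nabla>\<^sub>x\<^sup>2 g) + \<langle>B(T-t) x, \<nabla>\<^sub>x g\<rangle> + 1/2 Tr(B(T-t)) g = 0\<close> with initial
  datum \<open>g\<^sub>0\<close>, given by its Fourier transform; \<open>R\<close> is the resolvent of \<open>X' = B(T-t) X\<close>.\<close>

definition is_mild_solution ::
  "(real \<Rightarrow> real^'n^'n) \<Rightarrow> (real \<Rightarrow> real^'n^'n) \<Rightarrow> real \<Rightarrow> (real \<Rightarrow> real \<Rightarrow> real^'n^'n) \<Rightarrow>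
   (real^'n \<Rightarrow> complex) \<Rightarrow> (real \<Rightarrow> real^'n \<Rightarrow> complex) \<Rightarrow> bool" where
  "is_mild_solution A B T R g\<^sub>0 g \<longleftrightarrow>
     continuous_into_L2 T g \<and>
     (\<forall>t\<in>{0..T}. AE \<xi> in lebesgue.
        L2_fourier (g t) \<xi> =
          complex_of_real (exp (1/2 * integral {0..t} (\<lambda>s. trace (B (T - s)))))
          * L2_fourier g\<^sub>0 (transpose (R t 0) *v \<xi>)
          * complex_of_real (exp (- (1/2) * integral {0..t}
              (\<lambda>s. (norm (transpose (A (T - s)) *v (transpose (R t s) *v \<xi>)))\<^sup>2))))"

end

theory Submission
  imports Defs "HOL-Probability.Characteristic_Functions"
begin

text \<open>
  On the Fourier side the mild solution is explicit, and everything reduces to a pointwise estimate.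
  Write \<open>M\<close> for the transpose of \<open>R \<tau> t\<close>. The cocycle identity \<open>R \<tau> t ** R t s = R \<tau> s\<close>
  (\<open>resolvent_cocycle\<close>) turns the formula with initial time \<open>0\<close> into one with initial time \<open>t\<close>
  (\<open>mild_propagation\<close>): the transform of \<open>g \<tau>\<close> at \<open>\<xi>\<close> is
  \<open>exp (1/2 \<integral> Tr B)\<close> times the transform of \<open>g t\<close> at \<open>M \<xi>\<close>, times the Gaussian factor
  \<open>exp (- 1/2 \<integral> |A\<^sup>T (R \<tau> s)\<^sup>T \<xi>|\<^sup>2 ds)\<close> with \<open>s\<close> running over \<open>[t, \<tau>]\<close>. By Liouville's formula
  the first factor is \<open>sqrt (det M)\<close>, which is exactly the Jacobian that makes the substitution
  \<open>\<xi> \<mapsto> M \<xi>\<close> isometric on \<open>L\<^sup>2\<close>. Dropping the Gaussian factor therefore gives the contraction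
  \<open>\<parallel>g t\<parallel> \<le> \<parallel>g\<^sub>0\<parallel>\<close> with constant one.

  For the gain of derivatives, the exponent is bounded below. The admissibility condition bounds the
  integral with \<open>R t s\<close> in place of \<open>R \<tau> s\<close>; evaluating it at \<open>M \<xi>\<close> gives the required one,
  and \<open>|\<xi>| \<le> C |M \<xi>|\<close> because \<open>R t \<tau>\<close>, the inverse of \<open>R \<tau> t\<close>, is uniformly bounded
  (\<open>dissipation_lower_bound\<close>). So the exponent is at least \<open>a |\<xi>|\<^sup>2 / 2\<close> with
  \<open>a = c (\<tau> - t)^(2n-1) / C\<^sup>2\<close>, and \<open>|\<xi>|^k exp (- a |\<xi>|\<^sup>2 / 2) \<le> sqrt (k!) / a^(k/2)\<close> since
  \<open>y^k / k!\<close> is a term of the series of \<open>exp y\<close>. This is the estimate, with \<open>c\<^sub>0 = C / sqrt c\<close>.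

  To return from the Fourier side one needs Plancherel's theorem for the Fourier transform defined as
  a limit in mean: it is \<open>(2 \<pi>)^(n/2)\<close> times an isometry (\<open>plancherel\<close>), and it is onto
  (\<open>L2_fourier_surj\<close>), so that \<open>|\<xi>|^k\<close> times the transform of \<open>g \<tau>\<close> is the transform of some
  function \<open>h\<close>. The norm identity comes from inserting a Gaussian weight \<open>exp (- d\<^sup>2 |\<xi>|\<^sup>2 / 2)\<close>:
  the weighted energy of the transform of \<open>f\<close> is a multiple of the pairing of \<open>f\<close> with its average
  against the heat kernel at scale \<open>d\<close>. As \<open>d\<close> tends to \<open>0\<close> this gives an inequality for all \<open>f\<close>
  and, for continuous \<open>f\<close>, an equality, which density extends. Surjectivity is then soft: the
  formula \<open>\<integral> F(f) g = \<integral> f F(g)\<close> says that the adjoint of the transform is the transform up to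
  complex conjugation, and an isometry whose adjoint is an isometry is onto.
\<close>

section \<open>Linear changes of variables\<close>

text \<open>Gaussian elimination: both sides are multiplicative in the matrix, so it is enough to treat
  singular, diagonal, transposition and shear matrices. The index type carries no order, so the
  determinant of a shear is found by a row operation and not by triangularity.\<close>

lemma measure_matrix_image_cbox:
  fixes M :: "real^'n^'n"
  shows "measure lebesgue ((*v) M ` cbox a b) = \<bar>det M\<bar> * measure lebesgue (cbox a b)"
proof -
  have "\<forall>a b. measure lebesgue ((*v) M ` cbox a b) = \<bar>det M\<bar> * measure lebesgue (cbox a b)"
  proof (rule induct_matrix_elementary_alt; intro allI)
    fix A B :: "real^'n^'n" and a b
    assume A: "\<forall>a b. measure lebesgue ((*v) A ` cbox a b) = \<bar>det A\<bar> * measure lebesgue (cbox a b)"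
      and B: "\<forall>a b. measure lebesgue ((*v) B ` cbox a b) = \<bar>det B\<bar> * measure lebesgue (cbox a b)"
    have "(*v) B ` cbox a b \<in> lmeasurable"
      by (simp add: measurable_linear_image_interval)
    then have "measure lebesgue ((*v) A ` ((*v) B ` cbox a b)) = \<bar>det A\<bar> * measure lebesgue ((*v) B ` cbox a b)"
      using measure_linear_sufficient[of "(*v) A" "(*v) B ` cbox a b" "\<bar>det A\<bar>"] A
      by (metis matrix_vector_mul_linear)
    then show "measure lebesgue ((*v) (A ** B) ` cbox a b) = \<bar>det (A ** B)\<bar> * measure lebesgue (cbox a b)"
      using B by (simp add: image_image matrix_vector_mul_assoc det_mul abs_mult)
  next
    fix A :: "real^'n^'n" and i a b
    assume "row i A = 0"
    then have "det A = 0" by (rule det_zero_row)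
    then have "\<not> inj ((*v) A)"
      using det_nz_iff_inj[of "(*v) A"] by simp
    then show "measure lebesgue ((*v) A ` cbox a b) = \<bar>det A\<bar> * measure lebesgue (cbox a b)"
      using \<open>det A = 0\<close> by (simp add: negligible_imp_measure0 negligible_linear_singular_image)
  next
    fix A :: "real^'n^'n" and a b
    assume 0: "\<And>i j. i \<noteq> j \<Longrightarrow> A$i$j = 0"
    have "(*v) A = (\<lambda>x. \<chi> k. A$k$k * x$k)"
    proof (intro ext, simp add: vec_eq_iff matrix_vector_mult_def, intro allI)
      fix x :: "real^'n" and i
      have "(\<Sum>j\<in>UNIV. A $ i $ j * x $ j) = (\<Sum>j\<in>UNIV. if j = i then A $ i $ i * x $ i else 0)"
        by (rule sum.cong) (auto simp: 0)
      then show "(\<Sum>j\<in>UNIV. A $ i $ j * x $ j) = A $ i $ i * x $ i" by simp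
    qed
    then show "measure lebesgue ((*v) A ` cbox a b) = \<bar>det A\<bar> * measure lebesgue (cbox a b)"
      using measure_stretch[of "cbox a b" "\<lambda>k. A$k$k"] by (simp add: det_diagonal 0)
  next
    fix m n :: 'n and a b :: "real^'n"
    assume "m \<noteq> n"
    let ?A = "(\<chi> i j. mat 1 $ i $ Transposition.transpose m n j) :: real^'n^'n"
    let ?h = "\<lambda>v::real^'n. \<chi> i. v $ Transposition.transpose m n i"
    have eq: "(*v) ?A = ?h"
    proof (intro ext, simp add: vec_eq_iff matrix_vector_mult_def mat_def, intro allI)
      fix x :: "real^'n" and i
      have "(\<Sum>j\<in>UNIV. (if i = Transposition.transpose m n j then 1 else 0) * x $ j)
          = (\<Sum>j\<in>UNIV. if j = Transposition.transpose m n i then x $ j else 0)"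
        by (rule sum.cong) auto
      then show "(\<Sum>j\<in>UNIV. (if i = Transposition.transpose m n j then 1 else 0) * x $ j)
          = x $ Transposition.transpose m n i" by simp
    qed
    have hh: "?h (?h x) = x" for x
      by (simp add: vec_eq_iff)
    have mem: "?h x \<in> cbox (?h c) (?h d)" if "x \<in> cbox c d" for x c d
      using that by (simp add: mem_box_cart)
    have "?h ` cbox a b = cbox (?h a) (?h b)"
    proof (intro set_eqI iffI)
      fix y assume "y \<in> cbox (?h a) (?h b)"
      then have "?h y \<in> cbox (?h (?h a)) (?h (?h b))" by (rule mem)
      then have "?h y \<in> cbox a b" by (simp only: hh)
      then show "y \<in> ?h ` cbox a b"
        using hh[of y] by (metis image_eqI)
    qed (use mem in blast)
    moreover have "measure lebesgue (cbox (?h a) (?h b)) = measure lebesgue (cbox a b)"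
    proof -
      have "cbox (?h a) (?h b) = {} \<longleftrightarrow> cbox a b = {}"
        by (auto simp: interval_eq_empty_cart) (metis transpose_involutory)+
      moreover have "(\<Prod>i\<in>UNIV. b $ Transposition.transpose m n i - a $ Transposition.transpose m n i)
            = (\<Prod>i\<in>UNIV. b $ i - a $ i)"
        using prod.permute[OF permutes_swap_id, where S=UNIV and g="\<lambda>i. b $ i - a $ i", symmetric]
        by (simp add: o_def)
      ultimately show ?thesis
        by (simp add: content_cbox_if_cart)
    qed
    moreover have "\<bar>det ?A\<bar> = 1"
      by (simp add: det_permute_columns permutes_swap_id sign_swap_id abs_mult)
    ultimately show "measure lebesgue ((*v) ?A ` cbox a b) = \<bar>det ?A\<bar> * measure lebesgue (cbox a b)"
      by (simp add: eq)
  next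
    fix m n :: 'n and a b :: "real^'n"
    assume "m \<noteq> n"
    let ?A = "(\<chi> i j. of_bool (i = m \<and> j = n \<or> i = j)) :: real^'n^'n"
    let ?h = "\<lambda>x::real^'n. \<chi> i. if i = m then x$m + x$n else x$i"
    have A_eq: "?A = (\<chi> k. if k = m then row m (mat 1) + 1 *s row n (mat 1) else row k (mat 1))"
      using \<open>m \<noteq> n\<close> by (auto simp: vec_eq_iff row_def mat_def)
    have det: "det ?A = 1"
      unfolding A_eq by (simp only: det_row_operation[OF \<open>m \<noteq> n\<close>] det_I)
    have eq: "(*v) ?A = ?h"
    proof (intro ext, unfold vec_eq_iff, intro allI)
      fix x :: "real^'n" and i
      have "(?A *v x) $ i = (\<Sum>j\<in>UNIV. (if j = n then if i = m then x $ j else 0 else 0) + (if j = i then x $ j else 0))"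
        unfolding matrix_vector_mult_def vec_lambda_beta using \<open>m \<noteq> n\<close> by (intro sum.cong) auto
      then show "(?A *v x) $ i = ?h x $ i"
        by (simp add: sum.distrib)
    qed
    have "measure lebesgue (?h ` cbox a b) = measure lebesgue (cbox a b)"
    proof (cases "cbox a b = {}")
      case False
      \<comment> \<open>The volume of a sheared box is known when its \<open>n\<close>-th coordinates start at a nonnegative
        value; translating by \<open>w\<close> makes that lower end \<open>0\<close>.\<close>
      define w where "w = (\<chi> i. if i = n then - a $ n else 0)"
      have ne: "cbox (w + a) (w + b) \<noteq> {}"
        using False by (metis cbox_translation image_is_empty)
      have h_add: "?h (w + x) = ?h w + ?h x" for x
        by (simp add: vec_eq_iff)
      have "measure lebesgue (?h ` cbox (w + a) (w + b)) = measure lebesgue (cbox (w + a) (w + b))"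
        using \<open>m \<noteq> n\<close> ne by (intro measure_shear_interval) (auto simp: w_def)
      also have "\<dots> = measure lebesgue ((+) w ` cbox a b)"
        by (metis cbox_translation)
      also have "\<dots> = measure lebesgue (cbox a b)"
        by (rule measure_translation)
      finally have 1: "measure lebesgue (?h ` cbox (w + a) (w + b)) = measure lebesgue (cbox a b)" .
      have 2: "?h ` cbox (w + a) (w + b) = (+) (?h w) ` (?h ` cbox a b)"
        unfolding cbox_translation image_image using h_add by (simp only:)
      show ?thesis
        using 1 unfolding 2 measure_translation .
    qed simp
    then show "measure lebesgue ((*v) ?A ` cbox a b) = \<bar>det ?A\<bar> * measure lebesgue (cbox a b)"
      by (simp only: eq det abs_one mult_1)
  qed
  then show ?thesis by blast
qed

text \<open>Borel measures that agree on boxes are equal, and the preimage of a box is its image under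
  the inverse matrix.\<close>

lemma lborel_matrix_image:
  fixes M :: "real^'n^'n"
  assumes "det M \<noteq> 0"
  shows "lborel = density (distr lborel borel ((*v) M)) (\<lambda>_. ennreal \<bar>det M\<bar>)"
proof (rule lborel_eqI)
  fix l u :: "real^'n"
  assume le: "\<And>b. b \<in> Basis \<Longrightarrow> l \<bullet> b \<le> u \<bullet> b"
  have [measurable]: "(*v) M \<in> borel \<rightarrow>\<^sub>M borel"
    by (simp add: borel_measurable_continuous_onI continuous_intros)
  have "invertible M"
    using assms by (simp add: invertible_det_nz)
  then obtain N where MN: "M ** N = mat 1" and NM: "N ** M = mat 1"
    unfolding invertible_def by blast
  have det: "\<bar>det M\<bar> * \<bar>det N\<bar> = 1"
    using MN by (metis abs_1 abs_mult det_I det_mul)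
  have vimage: "(*v) M -` box l u = (*v) N ` box l u"
    using MN NM by (force simp: image_iff matrix_vector_mul_assoc)
  have meas: "(*v) N ` box l u \<in> lmeasurable \<and>
      \<bar>det N\<bar> * measure lebesgue (box l u) = measure lebesgue ((*v) N ` box l u)"
    by (rule measure_linear_sufficient) (auto simp: measure_matrix_image_cbox)
  have "emeasure lborel ((*v) M -` box l u) = emeasure lebesgue ((*v) N ` box l u)"
    unfolding vimage[symmetric] using measurable_sets_borel[of "(*v) M" borel "box l u"] by simp
  also have "\<dots> = ennreal (\<bar>det N\<bar> * measure lebesgue (box l u))"
    using meas by (simp add: emeasure_eq_measure2)
  finally have "ennreal \<bar>det M\<bar> * emeasure lborel ((*v) M -` box l u) = ennreal (measure lebesgue (box l u))"
    using det by (simp add: ennreal_mult'[symmetric] mult.assoc[symmetric])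
  also have "\<dots> = (\<Prod>b\<in>Basis. (u - l) \<bullet> b)"
    using le by (simp add: measure_lborel_box_eq)
  finally show "emeasure (density (distr lborel borel ((*v) M)) (\<lambda>_. ennreal \<bar>det M\<bar>)) (box l u)
      = ennreal (\<Prod>b\<in>Basis. (u - l) \<bullet> b)"
    by (simp add: emeasure_density emeasure_distr nn_integral_cmult_indicator)
qed simp

lemma
  fixes M :: "real^'n^'n"
  assumes "det M \<noteq> 0"
  shows lebesgue_matrix_image: "lebesgue = density (distr lebesgue lebesgue ((*v) M)) (\<lambda>_. ennreal \<bar>det M\<bar>)"
    and matrix_measurable_lebesgue: "(*v) M \<in> lebesgue \<rightarrow>\<^sub>M lebesgue"
proof -
  have [measurable]: "(*v) M \<in> borel \<rightarrow>\<^sub>M borel"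
    by (simp add: borel_measurable_continuous_onI continuous_intros)
  have "emeasure lborel S = 0 \<longleftrightarrow> emeasure (distr lebesgue lborel ((*v) M)) S = 0" if S: "S \<in> sets borel" for S
    using S assms
    by (subst lborel_matrix_image[OF assms])
       (simp add: distr_completion emeasure_density nn_integral_cmult cong: distr_cong)
  then have eq: "null_sets lborel = null_sets (distr lebesgue lborel ((*v) M))"
    by (auto simp: null_sets_def)
  show "(*v) M \<in> lebesgue \<rightarrow>\<^sub>M lebesgue"
    by (simp add: completion.measurable_completion2 eq measurable_completion)
  have "lebesgue = completion (density (distr lborel borel ((*v) M)) (\<lambda>_. ennreal \<bar>det M\<bar>))"
    using lborel_matrix_image[OF assms] by simp
  also have "\<dots> = density (completion (distr lebesgue lborel ((*v) M))) (\<lambda>_. ennreal \<bar>det M\<bar>)"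
    using assms by (auto intro!: completion_density_eq simp: distr_completion cong: distr_cong)
  also have "\<dots> = density (distr lebesgue lebesgue ((*v) M)) (\<lambda>_. ennreal \<bar>det M\<bar>)"
    by (subst completion.completion_distr_eq) (auto simp: eq measurable_completion)
  finally show "lebesgue = density (distr lebesgue lebesgue ((*v) M)) (\<lambda>_. ennreal \<bar>det M\<bar>)" .
qed

lemma nn_integral_matrix_image:
  fixes M :: "real^'n^'n"
  assumes "det M \<noteq> 0" and u: "u \<in> borel_measurable lebesgue"
  shows "ennreal \<bar>det M\<bar> * (\<integral>\<^sup>+x. u (M *v x) \<partial>lebesgue) = (\<integral>\<^sup>+x. u x \<partial>lebesgue)"
proof -
  note [measurable] = matrix_measurable_lebesgue[OF assms(1)] u
  have "(\<integral>\<^sup>+x. u x \<partial>lebesgue) = (\<integral>\<^sup>+x. u x \<partial>density (distr lebesgue lebesgue ((*v) M)) (\<lambda>_. ennreal \<bar>det M\<bar>))"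
    using lebesgue_matrix_image[OF assms(1)] by simp
  also have "\<dots> = ennreal \<bar>det M\<bar> * (\<integral>\<^sup>+x. u (M *v x) \<partial>lebesgue)"
    by (simp add: nn_integral_density nn_integral_distr nn_integral_cmult)
  finally show ?thesis by simp
qed

lemma AE_matrix_image:
  fixes M :: "real^'n^'n"
  assumes "det M \<noteq> 0" and P: "AE x in lebesgue. P x"
  shows "AE x in lebesgue. P (M *v x)"
proof -
  note M [measurable] = matrix_measurable_lebesgue[OF assms(1)]
  obtain N where N: "N \<in> null_sets lebesgue" "{x. \<not> P x} \<subseteq> N"
    using P by (auto simp: eventually_ae_filter)
  have "(*v) M -` N \<in> null_sets lebesgue"
  proof -
    have "N \<in> sets lebesgue" using N by auto
    have "ennreal \<bar>det M\<bar> * (\<integral>\<^sup>+x. indicator N (M *v x) \<partial>lebesgue) = emeasure lebesgue N"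
      by (subst nn_integral_matrix_image[OF assms(1)])
         (use \<open>N \<in> sets lebesgue\<close> in \<open>auto intro!: nn_integral_indicator borel_measurable_indicator\<close>)
    then have "(\<integral>\<^sup>+x. indicator N (M *v x) \<partial>lebesgue) = 0"
      using assms(1) N by (simp add: null_setsD1)
    then have "(\<integral>\<^sup>+x. indicator ((*v) M -` N) x \<partial>lebesgue) = 0"
      by (simp add: indicator_def vimage_def)
    moreover have "(*v) M -` N \<in> sets lebesgue"
      using measurable_sets[OF M \<open>N \<in> sets lebesgue\<close>] by simp
    ultimately show ?thesis by auto
  qed
  then show ?thesis
    by (rule AE_I') (use N in auto)
qed

section \<open>Linear differential equations and the resolvent\<close>

lemma bounded_bilinear_matrix_vector_mult:
  "bounded_bilinear ((*v) :: real^'n^'m \<Rightarrow> real^'n \<Rightarrow> real^'m)"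
  unfolding bilinear_conv_bounded_bilinear[symmetric] bilinear_def linear_iff
  by (simp add: matrix_vector_right_distrib matrix_vector_mult_add_rdistrib
      scaleR_matrix_vector_assoc[symmetric] matrix_vector_mult_scaleR)

lemma bounded_bilinear_matrix_mult:
  "bounded_bilinear ((**) :: real^'n^'m \<Rightarrow> real^'k^'n \<Rightarrow> real^'k^'m)"
  unfolding bilinear_conv_bounded_bilinear[symmetric] bilinear_def linear_iff
  by (simp add: vec_eq_iff matrix_matrix_mult_def distrib_left distrib_right sum.distrib
      sum_distrib_left mult_ac)

text \<open>The derivative of \<open>|x|\<^sup>2\<close> is at most \<open>2 K |x|\<^sup>2\<close> in absolute value, so \<open>exp (2 K s) |x s|\<^sup>2\<close> increases and
  \<open>exp (- 2 K s) |x s|\<^sup>2\<close> decreases; the first controls the solution backwards in time, the second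
  forwards. One estimate thus yields both uniqueness and uniform bounds for the resolvent, in
  either time direction.\<close>

lemma linear_ode_energy_bound:
  fixes x :: "real \<Rightarrow> real^'n"
  assumes x: "\<And>t. t \<in> {0..T} \<Longrightarrow> (x has_vector_derivative (B t *v x t)) (at t within {0..T})"
    and K: "\<And>t y. t \<in> {0..T} \<Longrightarrow> norm (B t *v y) \<le> K * norm (y :: real^'n)"
    and r: "r \<in> {0..T}" and t: "t \<in> {0..T}"
  shows "norm (x t) \<le> exp (K * \<bar>t - r\<bar>) * norm (x r)"
proof -
  have inner_bound: "\<bar>x s \<bullet> (B s *v x s)\<bar> \<le> K * (x s \<bullet> x s)" if "s \<in> {0..T}" for s
  proof -
    have "\<bar>x s \<bullet> (B s *v x s)\<bar> \<le> norm (x s) * norm (B s *v x s)"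
      by (rule Cauchy_Schwarz_ineq2)
    also have "\<dots> \<le> norm (x s) * (K * norm (x s))"
      using K[OF that] by (intro mult_left_mono) auto
    finally show ?thesis
      by (simp add: dot_square_norm power2_eq_square mult_ac)
  qed
  define \<phi> where "\<phi> c s = exp (2 * c * s) * (x s \<bullet> x s)" for c s
  have deriv: "(\<phi> c has_real_derivative
      exp (2 * c * s) * (2 * (c * (x s \<bullet> x s) + x s \<bullet> (B s *v x s)))) (at s within {0..T})"
    if "s \<in> {0..T}" for s c
  proof -
    have "((\<lambda>s. x s \<bullet> x s) has_real_derivative 2 * (x s \<bullet> (B s *v x s))) (at s within {0..T})"
      using has_derivative_inner[OF x[OF that, unfolded has_vector_derivative_def] x[OF that, unfolded has_vector_derivative_def]]
      unfolding has_field_derivative_def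
      by (rule has_derivative_eq_rhs) (auto simp: inner_commute algebra_simps)
    then show ?thesis
      unfolding \<phi>_def by (auto intro!: derivative_eq_intros simp: algebra_simps)
  qed
  have cont: "continuous_on {a..b} (\<phi> c)" if "a \<in> {0..T}" "b \<in> {0..T}" for a b c
  proof -
    have "continuous_on {0..T} (\<phi> c)"
      using deriv by (meson DERIV_continuous continuous_on_eq_continuous_within)
    then show ?thesis
      by (rule continuous_on_subset) (use that in auto)
  qed
  have mono: "\<phi> K a \<le> \<phi> K b" and antimono: "\<phi> (-K) b \<le> \<phi> (-K) a"
    if "a \<le> b" "a \<in> {0..T}" "b \<in> {0..T}" for a b
  proof -
    have deriv': "(\<phi> c has_real_derivative
      exp (2 * c * s) * (2 * (c * (x s \<bullet> x s) + x s \<bullet> (B s *v x s)))) (at s)"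
      if "a < s" "s < b" for s c
      using deriv[of s c] at_within_Icc_at[of 0 s T] that \<open>a \<in> {0..T}\<close> \<open>b \<in> {0..T}\<close> by auto
    have sub: "s \<in> {0..T}" if "a < s" "s < b" for s
      using that \<open>a \<in> {0..T}\<close> \<open>b \<in> {0..T}\<close> by auto
    show "\<phi> K a \<le> \<phi> K b"
    proof (rule DERIV_nonneg_imp_increasing_open[OF \<open>a \<le> b\<close> _ cont[OF that(2,3)]])
      fix s assume s: "a < s" "s < b"
      then show "\<exists>y. DERIV (\<phi> K) s :> y \<and> 0 \<le> y"
        using deriv'[OF s, of K] inner_bound[OF sub[OF s]] by (intro exI conjI) auto
    qed
    show "\<phi> (-K) b \<le> \<phi> (-K) a"
    proof (rule DERIV_nonpos_imp_decreasing_open[OF \<open>a \<le> b\<close> _ cont[OF that(2,3)]])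
      fix s assume s: "a < s" "s < b"
      then show "\<exists>y. DERIV (\<phi> (-K)) s :> y \<and> y \<le> 0"
        using deriv'[OF s, of "-K"] inner_bound[OF sub[OF s]]
        by (intro exI conjI) (auto simp: mult_le_0_iff)
    qed
  qed
  have "x t \<bullet> x t \<le> exp (2 * (K * \<bar>t - r\<bar>)) * (x r \<bullet> x r)"
  proof (cases "r \<le> t")
    case True
    have "x t \<bullet> x t = exp (2 * K * t) * \<phi> (-K) t"
      by (simp add: \<phi>_def mult.assoc[symmetric] exp_add[symmetric])
    also have "\<dots> \<le> exp (2 * K * t) * \<phi> (-K) r"
      using antimono[OF True r t] by simp
    also have "\<dots> = exp (2 * K * t + 2 * (-K) * r) * (x r \<bullet> x r)"
      by (simp only: \<phi>_def mult.assoc exp_add)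
    also have "2 * K * t + 2 * (-K) * r = 2 * (K * \<bar>t - r\<bar>)"
      using True by (simp add: algebra_simps)
    finally show ?thesis .
  next
    case False
    have "x t \<bullet> x t = exp (- (2 * K * t)) * \<phi> K t"
      by (simp add: \<phi>_def mult.assoc[symmetric] exp_add[symmetric])
    also have "\<dots> \<le> exp (- (2 * K * t)) * \<phi> K r"
      using mono[OF _ t r] False by simp
    also have "\<dots> = exp (- (2 * K * t) + 2 * K * r) * (x r \<bullet> x r)"
      by (simp only: \<phi>_def mult.assoc exp_add)
    also have "- (2 * K * t) + 2 * K * r = 2 * (K * \<bar>t - r\<bar>)"
      using False by (simp add: algebra_simps)
    finally show ?thesis .
  qed
  then have "(norm (x t))\<^sup>2 \<le> (exp (K * \<bar>t - r\<bar>) * norm (x r))\<^sup>2"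
    by (simp add: dot_square_norm power_mult_distrib exp_double[symmetric])
  then show ?thesis
    by (rule power2_le_imp_le) simp
qed

text \<open>By the product rule the derivative is the sum over \<open>i\<close> of the determinants in which row \<open>i\<close>
  of \<open>X\<close> is replaced by row \<open>i\<close> of \<open>B ** X\<close>. That row is a combination of the rows of \<open>X\<close>, and only
  the multiple \<open>B $ i $ i\<close> of row \<open>i\<close> itself survives, the others producing a repeated row.\<close>

lemma has_real_derivative_det:
  fixes X :: "real \<Rightarrow> real^'n^'n"
  assumes X: "(X has_vector_derivative (B ** X t)) (at t within S)"
  shows "((\<lambda>t. det (X t)) has_real_derivative (trace B * det (X t))) (at t within S)"
proof -
  let ?U = "UNIV :: 'n set"
  let ?P = "{p. p permutes ?U}"
  have entry: "((\<lambda>t. X t $ i $ j) has_derivative (\<lambda>h. h * (B ** X t) $ i $ j)) (at t within S)" for i j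
    using bounded_linear.has_derivative[OF bounded_linear_vec_nth
        bounded_linear.has_derivative[OF bounded_linear_vec_nth X[unfolded has_vector_derivative_def]]]
    by simp
  have summand: "((\<lambda>t. of_int (sign p) * (\<Prod>i\<in>?U. X t $ i $ p i)) has_real_derivative
      (\<Sum>i\<in>?U. of_int (sign p) * ((B ** X t) $ i $ p i * (\<Prod>j\<in>?U - {i}. X t $ j $ p j)))) (at t within S)" for p
    unfolding has_field_derivative_def
    by (rule has_derivative_eq_rhs[OF has_derivative_mult_right[OF has_derivative_prod[OF entry]]])
       (simp add: fun_eq_iff sum_distrib_left sum_distrib_right mult_ac)
  have replace_row: "(\<Sum>p\<in>?P. of_int (sign p) * (y $ p i * (\<Prod>j\<in>?U - {i}. X t $ j $ p j)))
      = det (\<chi> j. if j = i then y else X t $ j)" for i and y :: "real^'n"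
    unfolding det_def
  proof (rule sum.cong)
    fix p assume "p \<in> ?P"
    have "(\<Prod>j\<in>?U. (\<chi> j. if j = i then y else X t $ j) $ j $ p j) = y $ p i * (\<Prod>j\<in>?U - {i}. X t $ j $ p j)"
      by (subst prod.remove[of _ i]) auto
    then show "of_int (sign p) * (y $ p i * (\<Prod>j\<in>?U - {i}. X t $ j $ p j))
       = of_int (sign p) * (\<Prod>j\<in>?U. (\<chi> j. if j = i then y else X t $ j) $ j $ p j)"
      by simp
  qed simp
  have row_det: "det (\<chi> j. if j = i then (B ** X t) $ i else X t $ j) = B $ i $ i * det (X t)" for i
  proof -
    have "(B ** X t) $ i = (\<Sum>k\<in>?U. B $ i $ k *s X t $ k)"
      by (simp add: vec_eq_iff matrix_matrix_mult_def)
    then have "det (\<chi> j. if j = i then (B ** X t) $ i else X t $ j)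
        = det (\<chi> j. if j = i then \<Sum>k\<in>?U. B $ i $ k *s X t $ k else X t $ j)"
      by (simp only:)
    also have "\<dots> = (\<Sum>k\<in>?U. B $ i $ k * det (\<chi> j. if j = i then X t $ k else X t $ j))"
      by (subst det_linear_row_sum) (simp_all only: det_row_mul finite)
    also have "\<dots> = (\<Sum>k\<in>?U. if k = i then B $ i $ i * det (X t) else 0)"
    proof (rule sum.cong)
      fix k
      have "(\<chi> j. if j = i then X t $ i else X t $ j) = X t"
        by (simp add: vec_eq_iff)
      moreover have "det (\<chi> j. if j = i then X t $ k else X t $ j) = 0" if "k \<noteq> i"
        by (rule det_identical_rows[OF that]) (use that in \<open>simp add: row_def\<close>)
      ultimately show "B $ i $ k * det (\<chi> j. if j = i then X t $ k else X t $ j)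
          = (if k = i then B $ i $ i * det (X t) else 0)"
        by (cases "k = i"; simp only: if_True if_False mult_zero_right simp_thms)
    qed simp
    finally show ?thesis by simp
  qed
  have "(\<Sum>p\<in>?P. \<Sum>i\<in>?U. of_int (sign p) * ((B ** X t) $ i $ p i * (\<Prod>j\<in>?U - {i}. X t $ j $ p j)))
      = (\<Sum>i\<in>?U. det (\<chi> j. if j = i then (B ** X t) $ i else X t $ j))"
    by (subst sum.swap) (simp only: replace_row)
  also have "\<dots> = trace B * det (X t)"
    by (simp add: row_det trace_def sum_distrib_right)
  finally have sum_eq: "(\<Sum>p\<in>?P. \<Sum>i\<in>?U. of_int (sign p) * ((B ** X t) $ i $ p i * (\<Prod>j\<in>?U - {i}. X t $ j $ p j)))
      = trace B * det (X t)" .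
  show ?thesis
    unfolding det_def sum_eq[symmetric, unfolded det_def]
    by (rule DERIV_sum) (rule summand)
qed

lemma matrix_vector_mult_bound_on_compact:
  fixes M :: "'a::topological_space \<Rightarrow> real^'n^'m"
  assumes "compact S" "continuous_on S M"
  obtains K where "\<And>t y. t \<in> S \<Longrightarrow> norm (M t *v y) \<le> K * norm y"
proof -
  obtain c where c: "c > 0" "\<And>A y. norm ((A::real^'n^'m) *v y) \<le> norm A * norm y * c"
    using bounded_bilinear.pos_bounded[OF bounded_bilinear_matrix_vector_mult] by blast
  obtain b where b: "\<And>t. t \<in> S \<Longrightarrow> norm (M t) \<le> b"
    using compact_imp_bounded[OF compact_continuous_image[OF assms(2,1)]]
    by (auto simp: bounded_iff)
  have "norm (M t *v y) \<le> (b * c) * norm y" if "t \<in> S" for t y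
    using order_trans[OF c(2)[of "M t" y] mult_right_mono[OF mult_right_mono[OF b[OF that]]]] c(1)
    by (simp add: mult_ac)
  then show ?thesis by (rule that)
qed

lemma transpose_diff: "transpose (A - B) = transpose A - transpose (B :: real^'n^'m)"
  by (simp add: transpose_def vec_eq_iff)

text \<open>A matrix and its transpose have the same operator norm: test \<open>M\<close> on \<open>transpose M *v v\<close>.\<close>

lemma norm_transpose_mult_le:
  fixes M :: "real^'n^'n"
  assumes "\<And>v. norm (M *v v) \<le> C * norm v"
  shows "norm (transpose M *v v) \<le> C * norm v"
proof (cases "transpose M *v v = 0")
  case True
  have "0 \<le> C * norm v"
    using assms[of v] norm_ge_zero order_trans by blast
  then show ?thesis using True by simp
next
  case False
  let ?w = "transpose M *v v"
  have "(norm ?w)\<^sup>2 = v \<bullet> (M *v ?w)"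
    by (metis dot_lmul_matrix dot_square_norm inner_commute transpose_matrix_vector)
  also have "\<dots> \<le> norm v * (C * norm ?w)"
    using norm_cauchy_schwarz[of v "M *v ?w"] mult_left_mono[OF assms[of ?w], of "norm v"] by simp
  finally have "norm ?w * norm ?w \<le> (C * norm v) * norm ?w"
    by (simp add: power2_eq_square mult_ac)
  then show ?thesis
    using False by simp
qed

context
  fixes B :: "real \<Rightarrow> real^'n^'n" and T :: real and R :: "real \<Rightarrow> real \<Rightarrow> real^'n^'n"
  assumes R: "is_resolvent B T R"
    and B: "continuous_on {0..T} (\<lambda>t. B (T - t))"
begin

lemma resolvent_diag: "t \<in> {0..T} \<Longrightarrow> R t t = mat 1"
  using R by (simp add: is_resolvent_def)

lemma resolvent_deriv:
  "s \<in> {0..T} \<Longrightarrow> t \<in> {0..T} \<Longrightarrow>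
    ((\<lambda>t. R t s) has_vector_derivative (B (T - t) ** R t s)) (at t within {0..T})"
  using R by (simp add: is_resolvent_def)

text \<open>As functions of \<open>t\<close>, both sides solve the same equation and agree at \<open>t = r\<close>; the energy bound
  applied to their difference is uniqueness. The times are in no particular order, so this also
  shows that \<open>R s t\<close> is the inverse of \<open>R t s\<close>.\<close>

lemma resolvent_cocycle:
  assumes "r \<in> {0..T}" "s \<in> {0..T}" "t \<in> {0..T}"
  shows "R t r ** R r s = R t s"
proof -
  obtain K where K: "\<And>t y. t \<in> {0..T} \<Longrightarrow> norm (B (T - t) *v y) \<le> K * norm y"
    using matrix_vector_mult_bound_on_compact[OF _ B] by auto
  have "(R t r ** R r s) *v v = R t s *v v" for v
  proof -
    let ?x = "\<lambda>t. R t r *v (R r s *v v) - R t s *v v"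
    have "(?x has_vector_derivative (B (T - t) *v ?x t)) (at t within {0..T})" if "t \<in> {0..T}" for t
      using has_vector_derivative_diff[OF
          bounded_linear.has_vector_derivative[OF bounded_bilinear.bounded_linear_left[OF bounded_bilinear_matrix_vector_mult]
            resolvent_deriv[OF assms(1) that]]
          bounded_linear.has_vector_derivative[OF bounded_bilinear.bounded_linear_left[OF bounded_bilinear_matrix_vector_mult]
            resolvent_deriv[OF assms(2) that]]]
      by (simp add: matrix_vector_mul_assoc[symmetric] matrix_vector_mult_diff_distrib)
    then have "norm (?x t) \<le> exp (K * \<bar>t - r\<bar>) * norm (?x r)"
      by (rule linear_ode_energy_bound) (use K assms in auto)
    then show ?thesis
      by (simp add: resolvent_diag[OF assms(1)] matrix_vector_mul_assoc)
  qed
  then show ?thesis by (simp add: matrix_eq)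
qed

lemma resolvent_transpose_bound:
  obtains C where "C > 0"
    and "\<And>s t v. s \<in> {0..T} \<Longrightarrow> t \<in> {0..T} \<Longrightarrow> norm (transpose (R t s) *v v) \<le> C * norm v"
proof -
  obtain K where K: "\<And>t y. t \<in> {0..T} \<Longrightarrow> norm (B (T - t) *v y) \<le> K * norm y"
    using matrix_vector_mult_bound_on_compact[OF _ B] by auto
  have "norm (R t s *v v) \<le> exp (\<bar>K\<bar> * T) * norm v" if "s \<in> {0..T}" "t \<in> {0..T}" for s t v
  proof -
    have "((\<lambda>t. R t s *v v) has_vector_derivative (B (T - t) *v (R t s *v v))) (at t within {0..T})"
      if "t \<in> {0..T}" for t
      using bounded_linear.has_vector_derivative[OF bounded_bilinear.bounded_linear_left[OF bounded_bilinear_matrix_vector_mult]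
            resolvent_deriv[OF \<open>s \<in> {0..T}\<close> that], of v]
      by (simp add: matrix_vector_mul_assoc)
    then have "norm (R t s *v v) \<le> exp (K * \<bar>t - s\<bar>) * norm (R s s *v v)"
      by (rule linear_ode_energy_bound) (use K that in auto)
    also have "\<dots> \<le> exp (\<bar>K\<bar> * T) * norm v"
    proof -
      have "K * \<bar>t - s\<bar> \<le> \<bar>K\<bar> * T"
        using that by (intro mult_mono) auto
      then show ?thesis
        by (simp add: resolvent_diag[OF that(1)] mult_right_mono)
    qed
    finally show ?thesis .
  qed
  then show ?thesis
    by (intro that[of "exp (\<bar>K\<bar> * T)"] norm_transpose_mult_le) auto
qed

text \<open>The equation controls \<open>R\<close> in its first argument only. The cocycle identity transfers
  continuity to the second one, through \<open>R t s - R t s\<^sub>0 = R t s ** (mat 1 - R s s\<^sub>0)\<close>.\<close>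

lemma continuous_on_resolvent_transpose:
  assumes t: "t \<in> {0..T}"
  shows "continuous_on {0..T} (\<lambda>s. transpose (R t s) *v \<xi>)"
  unfolding continuous_on_eq_continuous_within continuous_within
proof
  fix s\<^sub>0 assume s\<^sub>0: "s\<^sub>0 \<in> {0..T}"
  obtain C where C: "C > 0"
    "\<And>s t v. s \<in> {0..T} \<Longrightarrow> t \<in> {0..T} \<Longrightarrow> norm (transpose (R t s) *v v) \<le> C * norm v"
    using resolvent_transpose_bound by blast
  obtain c where c: "c > 0" "\<And>A y. norm ((A::real^'n^'n) *v y) \<le> norm A * norm y * c"
    using bounded_bilinear.pos_bounded[OF bounded_bilinear_matrix_vector_mult] by blast
  have bound: "norm (transpose (R t s) *v \<xi> - transpose (R t s\<^sub>0) *v \<xi>)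
      \<le> norm (transpose (mat 1 - R s s\<^sub>0)) * (C * norm \<xi> * c)" if s: "s \<in> {0..T}" for s
  proof -
    have "R t s - R t s\<^sub>0 = R t s ** (mat 1 - R s s\<^sub>0)"
      using resolvent_cocycle[OF s s\<^sub>0 t] 
      by (simp add: bounded_bilinear.diff_right[OF bounded_bilinear_matrix_mult])
    then have "transpose (R t s) - transpose (R t s\<^sub>0) = transpose (mat 1 - R s s\<^sub>0) ** transpose (R t s)"
      by (metis matrix_transpose_mul transpose_diff)
    then have "norm (transpose (R t s) *v \<xi> - transpose (R t s\<^sub>0) *v \<xi>)
        = norm (transpose (mat 1 - R s s\<^sub>0) *v (transpose (R t s) *v \<xi>))"
      by (metis matrix_vector_mul_assoc matrix_vector_mult_diff_rdistrib)
    also have "\<dots> \<le> norm (transpose (mat 1 - R s s\<^sub>0)) * norm (transpose (R t s) *v \<xi>) * c"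
      by (rule c)
    also have "\<dots> \<le> norm (transpose (mat 1 - R s s\<^sub>0)) * (C * norm \<xi>) * c"
      using C(2)[OF s t] c(1) by (intro mult_right_mono mult_left_mono) auto
    finally show ?thesis by (simp add: mult_ac)
  qed
  have "((\<lambda>s. R s s\<^sub>0) \<longlongrightarrow> R s\<^sub>0 s\<^sub>0) (at s\<^sub>0 within {0..T})"
    using has_vector_derivative_continuous[OF resolvent_deriv[OF s\<^sub>0 s\<^sub>0]]
    by (simp add: continuous_within)
  then have "((\<lambda>s. norm (transpose (mat 1 - R s s\<^sub>0)) * (C * norm \<xi> * c)) \<longlongrightarrow>
      norm (transpose (mat 1 - R s\<^sub>0 s\<^sub>0)) * (C * norm \<xi> * c)) (at s\<^sub>0 within {0..T})"
    unfolding transpose_def by (intro tendsto_intros)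
  moreover have "transpose (mat 1 - R s\<^sub>0 s\<^sub>0) = 0"
    by (simp add: resolvent_diag[OF s\<^sub>0] transpose_def vec_eq_iff)
  ultimately have "((\<lambda>s. norm (transpose (mat 1 - R s s\<^sub>0)) * (C * norm \<xi> * c)) \<longlongrightarrow> 0) (at s\<^sub>0 within {0..T})"
    by simp
  then have "((\<lambda>s. transpose (R t s) *v \<xi> - transpose (R t s\<^sub>0) *v \<xi>) \<longlongrightarrow> 0) (at s\<^sub>0 within {0..T})"
    by (rule Lim_null_comparison[rotated])
       (use bound in \<open>auto simp: eventually_at_filter\<close>)
  then show "((\<lambda>s. transpose (R t s) *v \<xi>) \<longlongrightarrow> transpose (R t s\<^sub>0) *v \<xi>) (at s\<^sub>0 within {0..T})"
    by (simp add: LIM_zero_iff)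
qed

lemma continuous_on_trace_B: "continuous_on {0..T} (\<lambda>r. trace (B (T - r)))"
  unfolding trace_def by (intro continuous_intros B)

text \<open>The product of \<open>det (R t s)\<close> with the inverse of the right-hand side has derivative \<open>0\<close> and
  equals \<open>1\<close> at \<open>t = s\<close>.\<close>

lemma liouville:
  assumes "0 \<le> s" "s \<le> t" "t \<le> T"
  shows "det (R t s) = exp (integral {s..t} (\<lambda>r. trace (B (T - r))))"
proof -
  let ?b = "\<lambda>r. trace (B (T - r))"
  let ?G = "\<lambda>t. integral {s..t} ?b"
  let ?f = "\<lambda>t. exp (- ?G t) * det (R t s)"
  have "(?f has_real_derivative 0) (at r within {s..T})" if r: "r \<in> {s..T}" for r
  proof -
    have "((\<lambda>t. det (R t s)) has_real_derivative (?b r * det (R r s))) (at r within {0..T})"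
      using assms r by (intro has_real_derivative_det resolvent_deriv) auto
    then have "((\<lambda>t. det (R t s)) has_real_derivative (?b r * det (R r s))) (at r within {s..T})"
      by (rule DERIV_subset) (use assms in auto)
    moreover have "(?G has_real_derivative ?b r) (at r within {s..T})"
      using r assms by (intro integral_has_real_derivative continuous_on_subset[OF continuous_on_trace_B]) auto
    ultimately show ?thesis
      by (auto intro!: derivative_eq_intros simp: algebra_simps)
  qed
  then have "\<exists>c. \<forall>r\<in>{s..T}. ?f r = c"
    by (intro has_field_derivative_zero_constant) auto
  then obtain c where c: "\<And>r. r \<in> {s..T} \<Longrightarrow> ?f r = c" by blast
  have "?f t = ?f s"
    by (rule trans[OF c c[symmetric]]) (use assms in auto)
  also have "?f s = 1"
    using assms by (simp add: resolvent_diag)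
  finally show ?thesis
    by (simp add: exp_minus field_simps)
qed

end

section \<open>Square integrable functions\<close>

lemma L2_measurable [measurable_dest]: "f \<in> L2_space \<Longrightarrow> f \<in> borel_measurable lebesgue"
  and L2_integrable_sq: "f \<in> L2_space \<Longrightarrow> integrable lebesgue (\<lambda>x. (cmod (f x))\<^sup>2)"
  by (auto simp: L2_space_def)

lemma L2_norm_nonneg [simp]: "L2_norm f \<ge> 0"
  by (simp add: L2_norm_def)

lemma L2_norm_sq: "(L2_norm f)\<^sup>2 = (LINT x|lebesgue. (cmod (f x))\<^sup>2)"
  by (simp add: L2_norm_def)

lemma nn_integral_L2:
  assumes "f \<in> L2_space"
  shows "(\<integral>\<^sup>+x. ennreal ((cmod (f x))\<^sup>2) \<partial>lebesgue) = ennreal ((L2_norm f)\<^sup>2)"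
  unfolding L2_norm_sq by (rule nn_integral_eq_integral[OF L2_integrable_sq[OF assms]]) simp

lemma L2_I_nn_integral:
  assumes [measurable]: "f \<in> borel_measurable lebesgue"
    and le: "(\<integral>\<^sup>+x. ennreal ((cmod (f x))\<^sup>2) \<partial>lebesgue) \<le> ennreal (c\<^sup>2)" and "c \<ge> 0"
  shows "f \<in> L2_space" and "L2_norm f \<le> c"
proof -
  have "integrable lebesgue (\<lambda>x. (cmod (f x))\<^sup>2)"
    by (rule integrableI_bounded) (use le in \<open>auto intro: le_less_trans\<close>)
  then show f: "f \<in> L2_space" by (simp add: L2_space_def)
  show "L2_norm f \<le> c"
    using le \<open>c \<ge> 0\<close> unfolding nn_integral_L2[OF f] by (simp add: ennreal_le_iff power2_le_iff_abs_le)
qed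

lemma L2_dominated:
  assumes "f \<in> borel_measurable lebesgue" "g \<in> L2_space" "AE x in lebesgue. cmod (f x) \<le> cmod (g x)"
  shows "f \<in> L2_space" and "L2_norm f \<le> L2_norm g"
proof -
  have "(\<integral>\<^sup>+x. ennreal ((cmod (f x))\<^sup>2) \<partial>lebesgue) \<le> (\<integral>\<^sup>+x. ennreal ((cmod (g x))\<^sup>2) \<partial>lebesgue)"
    by (rule nn_integral_mono_AE) (use assms(3) in \<open>auto elim!: eventually_mono intro!: ennreal_leI power_mono\<close>)
  then have "(\<integral>\<^sup>+x. ennreal ((cmod (f x))\<^sup>2) \<partial>lebesgue) \<le> ennreal ((L2_norm g)\<^sup>2)"
    by (simp add: nn_integral_L2 assms)
  then show "f \<in> L2_space" "L2_norm f \<le> L2_norm g"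
    using L2_I_nn_integral[OF assms(1)] by auto
qed

lemma L2_cmult:
  assumes "f \<in> L2_space"
  shows "(\<lambda>x. c * f x) \<in> L2_space" and "L2_norm (\<lambda>x. c * f x) = cmod c * L2_norm f"
  using assms by (auto simp: L2_space_def L2_norm_def norm_mult power_mult_distrib real_sqrt_mult)

lemma L2_cnj:
  assumes "f \<in> L2_space"
  shows "(\<lambda>x. cnj (f x)) \<in> L2_space" and "L2_norm (\<lambda>x. cnj (f x)) = L2_norm f"
proof -
  have [measurable]: "cnj \<in> borel_measurable borel"
    by (intro borel_measurable_continuous_onI continuous_intros)
  show "(\<lambda>x. cnj (f x)) \<in> L2_space" "L2_norm (\<lambda>x. cnj (f x)) = L2_norm f"
    using assms by (auto simp: L2_space_def L2_norm_def)
qed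

lemma L2_mult_integrable:
  assumes f: "f \<in> L2_space" and g: "g \<in> L2_space"
  shows "integrable lebesgue (\<lambda>x. f x * g x)"
proof (rule Bochner_Integration.integrable_bound)
  note [measurable] = f g
  show "integrable lebesgue (\<lambda>x. (cmod (f x))\<^sup>2 + (cmod (g x))\<^sup>2)"
    by (intro Bochner_Integration.integrable_add L2_integrable_sq f g)
  have "a * b \<le> a\<^sup>2 + b\<^sup>2" for a b :: real
    using sum_squares_bound[of a b] sum_power2_ge_zero[of a b] by linarith
  then show "AE x in lebesgue. norm (f x * g x) \<le> norm ((cmod (f x))\<^sup>2 + (cmod (g x))\<^sup>2)"
    by (simp add: norm_mult)
  show "(\<lambda>x. f x * g x) \<in> borel_measurable lebesgue"
    by measurable
qed

lemma L2_mult_integrable_norm: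
  assumes f: "f \<in> L2_space" and g: "g \<in> L2_space"
  shows "integrable lebesgue (\<lambda>x. cmod (f x) * cmod (g x))"
  using integrable_norm[OF L2_mult_integrable[OF assms]] by (simp add: norm_mult)

text \<open>The quadratic polynomial \<open>t \<mapsto> \<integral> (|f| - t |g|)\<^sup>2\<close> is nonnegative.\<close>

lemma L2_Cauchy_Schwarz_norm:
  assumes f: "f \<in> L2_space" and g: "g \<in> L2_space"
  shows "(LINT x|lebesgue. cmod (f x) * cmod (g x)) \<le> L2_norm f * L2_norm g"
proof -
  define I where "I = (LINT x|lebesgue. cmod (f x) * cmod (g x))"
  have I0: "I \<ge> 0"
    unfolding I_def by (rule integral_nonneg_AE) simp
  have quad: "0 \<le> (L2_norm f)\<^sup>2 - 2 * t * I + t\<^sup>2 * (L2_norm g)\<^sup>2" for t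
  proof -
    have eq: "(\<lambda>x. (cmod (f x) - t * cmod (g x))\<^sup>2)
        = (\<lambda>x. (cmod (f x))\<^sup>2 - (2 * t) * (cmod (f x) * cmod (g x)) + t\<^sup>2 * (cmod (g x))\<^sup>2)"
      by (simp add: fun_eq_iff power2_diff power_mult_distrib algebra_simps)
    have "0 \<le> (LINT x|lebesgue. (cmod (f x) - t * cmod (g x))\<^sup>2)"
      by (rule integral_nonneg_AE) simp
    also have "\<dots> = (L2_norm f)\<^sup>2 - 2 * t * I + t\<^sup>2 * (L2_norm g)\<^sup>2"
      unfolding eq L2_norm_sq I_def
      by (subst Bochner_Integration.integral_add Bochner_Integration.integral_diff;
          (intro Bochner_Integration.integrable_diff integrable_mult_right L2_integrable_sq f g L2_mult_integrable_norm)?)+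
         simp
    finally show ?thesis .
  qed
  have "I \<le> L2_norm f * L2_norm g"
  proof (cases "L2_norm g = 0")
    case True
    \<comment> \<open>When \<open>\<parallel>g\<parallel> = 0\<close> the polynomial is affine in \<open>t\<close>; it would be negative for large \<open>t\<close> unless
      \<open>I\<close> vanished.\<close>
    have "I = 0"
    proof (rule ccontr)
      assume "I \<noteq> 0"
      then show False
        using quad[of "((L2_norm f)\<^sup>2 + 1) / (2 * I)"] True by simp
    qed
    then show ?thesis by simp
  next
    case False
    then have g0: "L2_norm g > 0"
      using L2_norm_nonneg[of g] by linarith
    have "0 \<le> (L2_norm f)\<^sup>2 - I\<^sup>2 / (L2_norm g)\<^sup>2"
      using quad[of "I / (L2_norm g)\<^sup>2"] g0 by (simp add: field_simps power2_eq_square)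
    then have "I\<^sup>2 \<le> (L2_norm f * L2_norm g)\<^sup>2"
      using g0 by (simp add: field_simps power_mult_distrib)
    then show ?thesis
      by (rule power2_le_imp_le) simp
  qed
  then show ?thesis by (simp add: I_def)
qed

lemma L2_Cauchy_Schwarz:
  assumes "f \<in> L2_space" and "g \<in> L2_space"
  shows "cmod (LINT x|lebesgue. f x * g x) \<le> L2_norm f * L2_norm g"
proof -
  have "cmod (LINT x|lebesgue. f x * g x) \<le> (LINT x|lebesgue. cmod (f x * g x))"
    by (rule integral_norm_bound)
  also have "\<dots> \<le> L2_norm f * L2_norm g"
    using L2_Cauchy_Schwarz_norm[OF assms] by (simp add: norm_mult)
  finally show ?thesis .
qed

lemma
  assumes f: "f \<in> L2_space" and g: "g \<in> L2_space"
  shows L2_add: "(\<lambda>x. f x + g x) \<in> L2_space"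
    and L2_triangle: "L2_norm (\<lambda>x. f x + g x) \<le> L2_norm f + L2_norm g"
proof -
  note [measurable] = f g
  let ?u = "\<lambda>x. (cmod (f x))\<^sup>2 + 2 * (cmod (f x) * cmod (g x)) + (cmod (g x))\<^sup>2"
  have int: "integrable lebesgue ?u"
    by (intro Bochner_Integration.integrable_add integrable_mult_right L2_integrable_sq L2_mult_integrable_norm f g)
  have le: "(cmod (f x + g x))\<^sup>2 \<le> ?u x" for x
  proof -
    have "(cmod (f x + g x))\<^sup>2 \<le> (cmod (f x) + cmod (g x))\<^sup>2"
      by (intro power_mono norm_triangle_ineq) simp
    then show ?thesis by (simp add: power2_sum algebra_simps)
  qed
  have intl: "integrable lebesgue (\<lambda>x. (cmod (f x + g x))\<^sup>2)"
    by (rule Bochner_Integration.integrable_bound[OF int]) (use le in \<open>auto intro: order_trans\<close>)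
  then show "(\<lambda>x. f x + g x) \<in> L2_space"
    by (simp add: L2_space_def)
  have "(L2_norm (\<lambda>x. f x + g x))\<^sup>2 \<le> integral\<^sup>L lebesgue ?u"
    unfolding L2_norm_sq by (rule integral_mono[OF intl int le])
  also have "\<dots> = (L2_norm f)\<^sup>2 + 2 * (LINT x|lebesgue. cmod (f x) * cmod (g x)) + (L2_norm g)\<^sup>2"
    unfolding L2_norm_sq
    by (subst Bochner_Integration.integral_add;
        (intro Bochner_Integration.integrable_add integrable_mult_right L2_integrable_sq f g L2_mult_integrable_norm)?)+
       simp
  also have "\<dots> \<le> (L2_norm f + L2_norm g)\<^sup>2"
    using L2_Cauchy_Schwarz_norm[OF f g] by (simp add: power2_sum)
  finally show "L2_norm (\<lambda>x. f x + g x) \<le> L2_norm f + L2_norm g"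
    by (rule power2_le_imp_le) (simp add: add_nonneg_nonneg)
qed

lemma
  assumes f: "f \<in> L2_space" and g: "g \<in> L2_space"
  shows L2_diff: "(\<lambda>x. f x - g x) \<in> L2_space"
    and L2_triangle_diff: "L2_norm f \<le> L2_norm (\<lambda>x. f x - g x) + L2_norm g"
proof -
  show d: "(\<lambda>x. f x - g x) \<in> L2_space"
    using L2_add[OF f L2_cmult(1)[OF g, of "-1"]] by simp
  show "L2_norm f \<le> L2_norm (\<lambda>x. f x - g x) + L2_norm g"
    using L2_triangle[OF d g] by simp
qed

lemma L2_norm_minus_commute: "L2_norm (\<lambda>x. f x - g x) = L2_norm (\<lambda>x. g x - f x)"
  by (simp add: L2_norm_def norm_minus_commute)

lemma L2_triangle_mid:
  assumes "f \<in> L2_space" "g \<in> L2_space" "h \<in> L2_space"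
  shows "L2_norm (\<lambda>x. f x - h x) \<le> L2_norm (\<lambda>x. f x - g x) + L2_norm (\<lambda>x. g x - h x)"
  using L2_triangle[OF L2_diff[OF assms(1,2)] L2_diff[OF assms(2,3)]] by simp

lemma L2_norm_diff_le:
  assumes "f \<in> L2_space" "g \<in> L2_space"
  shows "\<bar>L2_norm f - L2_norm g\<bar> \<le> L2_norm (\<lambda>x. f x - g x)"
  using L2_triangle_diff[OF assms] L2_triangle_diff[OF assms(2,1)] L2_norm_minus_commute[of f g]
  by linarith

lemma L2_norm_eq_0_AE:
  assumes "f \<in> L2_space" "L2_norm f = 0"
  shows "AE x in lebesgue. f x = 0"
proof -
  have "(LINT x|lebesgue. (cmod (f x))\<^sup>2) = 0"
    using assms(2) by (simp add: L2_norm_def)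
  then have "AE x in lebesgue. (cmod (f x))\<^sup>2 = 0"
    using integral_nonneg_eq_0_iff_AE[OF L2_integrable_sq[OF assms(1)]] by simp
  then show ?thesis by simp
qed

lemma L2_dominated_convergence:
  fixes s :: "nat \<Rightarrow> 'a::euclidean_space \<Rightarrow> complex"
  assumes s: "\<And>n. s n \<in> borel_measurable lebesgue" and f: "f \<in> borel_measurable lebesgue"
    and w: "w \<in> L2_space"
    and lim: "AE x in lebesgue. (\<lambda>n. s n x) \<longlonglongrightarrow> f x"
    and bound: "\<And>n. AE x in lebesgue. cmod (s n x) \<le> cmod (w x)"
  shows "f \<in> L2_space" and "\<And>n. s n \<in> L2_space" and "(\<lambda>n. L2_norm (\<lambda>x. s n x - f x)) \<longlonglongrightarrow> 0"
proof -
  note [measurable] = s f w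
  have fw: "AE x in lebesgue. cmod (f x) \<le> cmod (w x)"
  proof -
    have "AE x in lebesgue. \<forall>n. cmod (s n x) \<le> cmod (w x)"
      using bound by (simp add: AE_all_countable)
    with lim show ?thesis
      by eventually_elim (rule LIMSEQ_le_const2[OF tendsto_norm], auto)
  qed
  show "f \<in> L2_space" "\<And>n. s n \<in> L2_space"
    using L2_dominated(1)[OF f w fw] L2_dominated(1)[OF s w bound] by auto
  have "(\<lambda>n. LINT x|lebesgue. (cmod (s n x - f x))\<^sup>2) \<longlonglongrightarrow> (LINT x|(lebesgue::'a measure). 0)"
  proof (rule integral_dominated_convergence[where w="\<lambda>x. 4 * (cmod (w x))\<^sup>2"])
    show "integrable lebesgue (\<lambda>x. 4 * (cmod (w x))\<^sup>2)"
      by (intro integrable_mult_right L2_integrable_sq w)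
    show "AE x in lebesgue. (\<lambda>n. (cmod (s n x - f x))\<^sup>2) \<longlonglongrightarrow> 0"
      using lim
    proof eventually_elim
      case (elim x)
      then have "(\<lambda>n. (cmod (s n x - f x))\<^sup>2) \<longlonglongrightarrow> (cmod (f x - f x))\<^sup>2"
        by (intro tendsto_intros)
      then show ?case by simp
    qed
    show "AE x in lebesgue. norm ((cmod (s n x - f x))\<^sup>2) \<le> 4 * (cmod (w x))\<^sup>2" for n
      using bound[of n] fw
    proof eventually_elim
      case (elim x)
      then have "cmod (s n x - f x) \<le> 2 * cmod (w x)"
        using norm_triangle_ineq4[of "s n x" "f x"] by linarith
      then have "(cmod (s n x - f x))\<^sup>2 \<le> (2 * cmod (w x))\<^sup>2"
        by (intro power_mono) auto
      then show ?case by simp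
    qed
  qed measurable
  then show "(\<lambda>n. L2_norm (\<lambda>x. s n x - f x)) \<longlonglongrightarrow> 0"
    using tendsto_real_sqrt[where x=0] by (fastforce simp: L2_norm_def)
qed

text \<open>Along a subsequence whose increments \<open>d k\<close> satisfy \<open>\<parallel>d k\<parallel> \<le> 2^(-k)\<close>, the function
  \<open>\<Sum> 2^k |d k|\<^sup>2\<close> has finite integral. Hence it is finite almost everywhere, which forces
  \<open>|d k x|\<close> to decay geometrically; so the subsequence converges almost everywhere, and Fatou's
  lemma identifies the limit in norm. The weights \<open>2^k\<close> replace Minkowski's inequality for
  infinitely many terms.\<close>

lemma L2_complete:
  fixes u :: "nat \<Rightarrow> 'a::euclidean_space \<Rightarrow> complex"
  assumes u: "\<And>n. u n \<in> L2_space"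
    and Cauchy: "\<And>e. e > 0 \<Longrightarrow> \<exists>N. \<forall>m\<ge>N. \<forall>n\<ge>N. L2_norm (\<lambda>x. u m x - u n x) < e"
  obtains F where "F \<in> L2_space" "(\<lambda>n. L2_norm (\<lambda>x. u n x - F x)) \<longlonglongrightarrow> 0"
proof -
  note [measurable] = u
  have "\<exists>N. \<forall>m\<ge>N. \<forall>n\<ge>N. L2_norm (\<lambda>x. u m x - u n x) < (1/2)^k" for k :: nat
    by (rule Cauchy) simp
  then obtain N where N: "\<And>k m n. m \<ge> N k \<Longrightarrow> n \<ge> N k \<Longrightarrow> L2_norm (\<lambda>x. u m x - u n x) < (1/2)^k"
    by metis
  define s where "s k = (\<Sum>j\<le>k. N j)" for k
  have s_ge: "N j \<le> s k" if "j \<le> k" for j k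
    unfolding s_def by (rule member_le_sum) (use that in auto)
  define d where "d k x = u (s (Suc k)) x - u (s k) x" for k x
  have d: "d k \<in> L2_space" for k
    unfolding d_def using u by (intro L2_diff)
  note [measurable] = d
  have d_norm: "L2_norm (d k) \<le> (1/2)^k" for k
    unfolding d_def using N[OF s_ge s_ge, of k "Suc k" k] by (simp add: less_imp_le)
  \<comment> \<open>The weighted sum of squares is integrable: its integral is at most \<open>\<Sum> 2^k 4^(-k)\<close>.\<close>
  have "(\<integral>\<^sup>+x. (\<Sum>k. ennreal (2^k * (cmod (d k x))\<^sup>2)) \<partial>lebesgue)
      = (\<Sum>k. (\<integral>\<^sup>+x. ennreal (2^k * (cmod (d k x))\<^sup>2) \<partial>lebesgue))"
    by (rule nn_integral_suminf) measurable
  also have "\<dots> = (\<Sum>k. ennreal (2^k * (L2_norm (d k))\<^sup>2))"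
    by (simp add: ennreal_mult nn_integral_cmult nn_integral_L2[OF d])
  also have "\<dots> \<le> (\<Sum>k. ennreal ((1/2)^k))"
  proof (rule suminf_le)
    fix k
    have "2^k * (L2_norm (d k))\<^sup>2 \<le> 2^k * ((1/2)^k)\<^sup>2"
      by (intro mult_left_mono power_mono d_norm) auto
    also have "\<dots> = (1/2)^k"
      by (simp add: power2_eq_square power_mult_distrib[symmetric] mult.assoc[symmetric])
    finally show "ennreal (2^k * (L2_norm (d k))\<^sup>2) \<le> ennreal ((1/2)^k)"
      by (rule ennreal_leI)
  qed auto
  also have "\<dots> = ennreal (\<Sum>k. (1/2)^k)"
    by (rule suminf_ennreal2) (auto simp: summable_geometric)
  also have "\<dots> < \<infinity>" by simp
  finally have "AE x in lebesgue. (\<Sum>k. ennreal (2^k * (cmod (d k x))\<^sup>2)) \<noteq> \<infinity>"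
    by (intro nn_integral_noteq_infinite) auto
  then have conv: "AE x in lebesgue. convergent (\<lambda>k. u (s k) x)"
  proof eventually_elim
    case (elim x)
    define S where "S = (\<Sum>k. ennreal (2^k * (cmod (d k x))\<^sup>2))"
    have "S \<noteq> \<infinity>" using elim by (simp only: S_def not_False_eq_True)
    then obtain C where C: "S = ennreal C" "C \<ge> 0"
      by (cases S rule: ennreal_cases) auto
    have "cmod (d k x) \<le> sqrt C * (sqrt (1/2))^k" for k
    proof -
      have "ennreal (2^k * (cmod (d k x))\<^sup>2) \<le> ennreal C"
        unfolding C(1)[symmetric] S_def
        by (rule order_trans[OF _ sum_le_suminf[OF summableI, of "{k}"]]) auto
      then have "2^k * (cmod (d k x))\<^sup>2 \<le> C"
        by (simp only: ennreal_le_iff[OF C(2)])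
      then have "(cmod (d k x))\<^sup>2 \<le> C * (1/2)^k"
        by (simp add: field_simps)
      then have "cmod (d k x) \<le> sqrt (C * (1/2)^k)"
        by (rule real_le_rsqrt)
      then show ?thesis
        by (simp add: real_sqrt_mult real_sqrt_power)
    qed
    moreover have "summable (\<lambda>k. sqrt C * (sqrt (1/2))^k)"
      by (intro summable_mult summable_geometric) (simp add: real_sqrt_divide)
    ultimately have "summable (\<lambda>k. d k x)"
      by (rule summable_comparison_test'[where N=0, rotated])
    then have "convergent (\<lambda>n. u (s 0) x + (\<Sum>k<n. d k x))"
      unfolding summable_iff_convergent by (rule convergent_add[OF convergent_const])
    moreover have "u (s 0) x + (\<Sum>k<n. d k x) = u (s n) x" for n
      using sum_lessThan_telescope[of "\<lambda>k. u (s k) x" n] by (simp add: d_def)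
    ultimately show ?case by (simp only:)
  qed
  define F where "F x = lim (\<lambda>k. u (s k) x)" for x
  have F_meas [measurable]: "F \<in> borel_measurable lebesgue"
    unfolding F_def by measurable
  have F_lim: "AE x in lebesgue. (\<lambda>k. u (s k) x) \<longlonglongrightarrow> F x"
    using conv unfolding F_def by (simp add: convergent_LIMSEQ_iff)
  have close: "(\<lambda>x. u n x - F x) \<in> L2_space" "L2_norm (\<lambda>x. u n x - F x) \<le> (1/2)^j" if n: "n \<ge> N j" for n j
  proof -
    have "(\<integral>\<^sup>+x. ennreal ((cmod (u n x - F x))\<^sup>2) \<partial>lebesgue)
        = (\<integral>\<^sup>+x. liminf (\<lambda>k. ennreal ((cmod (u n x - u (s k) x))\<^sup>2)) \<partial>lebesgue)"
    proof (rule nn_integral_cong_AE)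
      show "AE x in lebesgue. ennreal ((cmod (u n x - F x))\<^sup>2)
          = liminf (\<lambda>k. ennreal ((cmod (u n x - u (s k) x))\<^sup>2))"
        using F_lim
      proof eventually_elim
        case (elim x)
        then have "(\<lambda>k. ennreal ((cmod (u n x - u (s k) x))\<^sup>2)) \<longlonglongrightarrow> ennreal ((cmod (u n x - F x))\<^sup>2)"
          by (intro tendsto_intros)
        then show ?case
          by (rule lim_imp_Liminf[OF sequentially_bot, symmetric])
      qed
    qed
    also have "\<dots> \<le> liminf (\<lambda>k. \<integral>\<^sup>+x. ennreal ((cmod (u n x - u (s k) x))\<^sup>2) \<partial>lebesgue)"
      by (rule nn_integral_liminf) measurable
    also have "\<dots> \<le> ennreal (((1/2)^j)\<^sup>2)"
    proof (rule Liminf_le)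
      have "(\<integral>\<^sup>+x. ennreal ((cmod (u n x - u (s k) x))\<^sup>2) \<partial>lebesgue) \<le> ennreal (((1/2)^j)\<^sup>2)"
        if "k \<ge> j" for k
        using N[OF n s_ge[OF that]]
        by (subst nn_integral_L2[OF L2_diff[OF u u]]) (auto intro!: ennreal_leI power_mono)
      then show "\<forall>\<^sub>F k in sequentially. (\<integral>\<^sup>+x. ennreal ((cmod (u n x - u (s k) x))\<^sup>2) \<partial>lebesgue)
          \<le> ennreal (((1/2)^j)\<^sup>2)"
        by (rule eventually_sequentiallyI)
    qed simp
    finally show "(\<lambda>x. u n x - F x) \<in> L2_space" "L2_norm (\<lambda>x. u n x - F x) \<le> (1/2)^j"
      by (auto intro: L2_I_nn_integral)
  qed
  have "F \<in> L2_space"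
    using L2_diff[OF u[of "N 0"] close(1)[of 0 "N 0"]] by simp
  moreover have "(\<lambda>n. L2_norm (\<lambda>x. u n x - F x)) \<longlonglongrightarrow> 0"
  proof (rule LIMSEQ_I)
    fix e :: real assume "e > 0"
    then obtain j where "(1/2)^j < e"
      using real_arch_pow_inv[of e "1/2"] by auto
    then show "\<exists>N. \<forall>n\<ge>N. norm (L2_norm (\<lambda>x. u n x - F x) - 0) < e"
      using close(2)[of j] by (intro exI[of _ "N j"]) (auto intro: le_less_trans)
  qed
  ultimately show ?thesis by (rule that)
qed

text \<open>Multiplication by the indicator of a ball, as in the definition of the Fourier transform as a
  limit in mean. Truncations of square integrable functions are also integrable.\<close>

definition trunc :: "real \<Rightarrow> ('a::euclidean_space \<Rightarrow> complex) \<Rightarrow> 'a \<Rightarrow> complex" where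
  "trunc r f x = indicator (cball 0 r) x *\<^sub>R f x"

lemma trunc_measurable:
  assumes "f \<in> borel_measurable lebesgue"
  shows "trunc r f \<in> borel_measurable lebesgue"
  unfolding trunc_def
  by (intro borel_measurable_scaleR borel_measurable_indicator assms) simp

lemma trunc_const_L2: "trunc r (\<lambda>_::'a::euclidean_space. c) \<in> L2_space"
proof -
  have eq: "(\<lambda>x. (cmod (trunc r (\<lambda>_. c) x))\<^sup>2) = (\<lambda>x::'a. (cmod c)\<^sup>2 * indicat_real (cball 0 r) x)"
    by (auto simp: trunc_def fun_eq_iff indicator_def)
  have "integrable lebesgue (\<lambda>x::'a. (cmod c)\<^sup>2 * indicat_real (cball 0 r) x)"
    using lmeasurable_cball[of "0::'a" r]
    by (intro integrable_mult_right integrable_real_indicator) (auto simp: fmeasurable_def)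
  then show ?thesis
    unfolding L2_space_def mem_Collect_eq eq by (auto intro: trunc_measurable)
qed

lemma trunc_L2:
  assumes "f \<in> L2_space"
  shows "trunc r f \<in> L2_space" and "integrable lebesgue (trunc r f)"
proof -
  show "trunc r f \<in> L2_space"
    by (rule L2_dominated(1)[OF trunc_measurable assms])
       (use assms in \<open>auto simp: trunc_def indicator_def dest: L2_measurable\<close>)
  have "trunc r f = (\<lambda>x. trunc r (\<lambda>_. 1) x * f x)"
    by (simp add: trunc_def fun_eq_iff)
  then show "integrable lebesgue (trunc r f)"
    using L2_mult_integrable[OF trunc_const_L2 assms] by simp
qed

lemma trunc_tendsto:
  fixes f :: "'a::euclidean_space \<Rightarrow> complex"
  assumes f: "f \<in> L2_space"
  shows "((\<lambda>r. L2_norm (\<lambda>x. trunc r f x - f x)) \<longlongrightarrow> 0) at_top"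
proof (rule tendsto_at_topI_sequentially)
  fix X :: "nat \<Rightarrow> real" assume X: "filterlim X at_top sequentially"
  show "(\<lambda>n. L2_norm (\<lambda>x. trunc (X n) f x - f x)) \<longlonglongrightarrow> 0"
  proof (rule L2_dominated_convergence(3)[where w=f])
    show "AE x in lebesgue. (\<lambda>n. trunc (X n) f x) \<longlonglongrightarrow> f x"
    proof (rule AE_I2)
      fix x :: 'a
      have "\<forall>\<^sub>F n in sequentially. norm x \<le> X n"
        using X by (simp add: filterlim_at_top)
      then have "\<forall>\<^sub>F n in sequentially. trunc (X n) f x = f x"
        by eventually_elim (simp add: trunc_def)
      then show "(\<lambda>n. trunc (X n) f x) \<longlonglongrightarrow> f x"
        by (rule tendsto_eventually)
    qed
    show "AE x in lebesgue. cmod (trunc (X n) f x) \<le> cmod (f x)" for n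
      by (simp add: trunc_def indicator_def)
  qed (use f trunc_L2[OF f] in \<open>auto dest: L2_measurable\<close>)
qed

text \<open>A Lebesgue measurable function is almost everywhere a limit of continuous functions \<open>h n\<close>,
  with no control on their size. Clamping the values to modulus at most \<open>m\<close> and multiplying by a
  continuous cutoff makes them dominated, so that the convergence also holds in norm.\<close>

lemma L2_dense_continuous:
  fixes f :: "'a::euclidean_space \<Rightarrow> complex"
  assumes f: "f \<in> L2_space" and "e > 0"
  obtains g b r where "continuous_on UNIV g" "\<And>x. cmod (g x) \<le> b" "\<And>x. norm x > r \<Longrightarrow> g x = 0"
    "g \<in> L2_space" "L2_norm (\<lambda>x. f x - g x) < e"
proof -
  obtain Z h where Z: "negligible Z" and h: "\<And>n. continuous_on UNIV (h n)"
    and h_lim: "\<And>x. x \<notin> Z \<Longrightarrow> (\<lambda>n. h n x) \<longlonglongrightarrow> f x"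
    using lebesgue_measurable_imp_measurable_on[OF L2_measurable[OF f], of UNIV]
    unfolding measurable_on_def by auto
  have h_AE: "AE x in lebesgue. (\<lambda>n. h n x) \<longlonglongrightarrow> f x"
    by (rule AE_I'[of Z]) (use Z h_lim in \<open>auto simp: negligible_iff_null_sets\<close>)
  define clamp where "clamp m z = complex_of_real (1 / max 1 (cmod z / m)) * z" for m :: real and z
  define cut where "cut m x = complex_of_real (max 0 (min 1 (m + 1 - norm x)))" for m :: real and x :: 'a
  define g where "g m k x = cut m x * clamp m k" for m k x
  have clamp_le: "cmod (clamp m z) \<le> m" "cmod (clamp m z) \<le> cmod z" if "m > 0" for m z
    using that by (auto simp: clamp_def norm_mult norm_divide field_simps max_def)
  have cut_le: "cmod (cut m x) \<le> 1" for m x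
    by (auto simp: cut_def)
  have cut_0: "cut m x = 0" if "norm x > m + 1" for m x
    using that by (simp add: cut_def)
  have cont_clamp: "continuous_on UNIV (clamp m)" if "m > 0" for m
    unfolding clamp_def using that by (intro continuous_intros) auto
  have cont_cut: "continuous_on UNIV (cut m)" for m
    unfolding cut_def by (intro continuous_intros)
  have [measurable]: "cut m \<in> borel_measurable lebesgue" for m
    using borel_measurable_continuous_onI[OF cont_cut] by (simp add: measurable_completion)
  have [measurable]: "clamp m \<in> borel_measurable borel" if "m > 0" for m
    using borel_measurable_continuous_onI[OF cont_clamp[OF that]] .
  have [measurable]: "h n \<in> borel_measurable lebesgue" for n
    using borel_measurable_continuous_onI[OF h] by (simp add: measurable_completion)
  note [measurable] = f
  \<comment> \<open>First clamp and cut off \<open>f\<close> itself, at a level \<open>m\<close> with error below \<open>e/2\<close>.\<close>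
  have "(\<lambda>m. L2_norm (\<lambda>x. g (real (Suc m)) (f x) x - f x)) \<longlonglongrightarrow> 0"
  proof (rule L2_dominated_convergence(3)[where w=f])
    show "AE x in lebesgue. (\<lambda>m. g (real (Suc m)) (f x) x) \<longlonglongrightarrow> f x"
    proof (rule AE_I2)
      fix x :: 'a
      obtain M where M: "norm x \<le> real M" "cmod (f x) \<le> real M"
        using real_arch_simple[of "max (norm x) (cmod (f x))"] by auto
      have "g (real (Suc m)) (f x) x = f x" if "m \<ge> M" for m
      proof -
        have "norm x \<le> real m" "cmod (f x) \<le> real m" using M that by linarith+
        then have "cmod (f x) / (1 + real m) \<le> 1" "norm x \<le> real m"
          by (simp_all add: field_simps)
        then show ?thesis by (simp add: g_def cut_def clamp_def max_def)
      qed
      then show "(\<lambda>m. g (real (Suc m)) (f x) x) \<longlonglongrightarrow> f x"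
        by (intro tendsto_eventually eventually_sequentiallyI)
    qed
    show "AE x in lebesgue. cmod (g (real (Suc m)) (f x) x) \<le> cmod (f x)" for m
    proof (rule AE_I2)
      fix x :: 'a
      show "cmod (g (real (Suc m)) (f x) x) \<le> cmod (f x)"
        using mult_mono[OF cut_le[of "real (Suc m)" x] clamp_le(2)[of "real (Suc m)" "f x"]]
        by (simp add: g_def norm_mult)
    qed
  qed (use f in \<open>auto simp: g_def\<close>)
  from order_tendstoD(2)[OF this, of "e/2"] \<open>e > 0\<close>
  obtain m :: nat where m: "L2_norm (\<lambda>x. g (real (Suc m)) (f x) x - f x) < e / 2"
    by (auto dest: eventually_happens'[OF sequentially_bot])
  define M where "M = real (Suc m)"
  have M: "M > 0" by (simp add: M_def)
  have g_le: "cmod (g M z x) \<le> M" for z x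
    using mult_mono[OF cut_le[of M x] clamp_le(1)[OF M, of z]] M by (simp add: g_def norm_mult)
  define w where "w = trunc (M + 1) (\<lambda>x::'a. complex_of_real M)"
  have w: "w \<in> L2_space"
    unfolding w_def by (rule trunc_const_L2)
  have g_w: "cmod (g M z x) \<le> cmod (w x)" for z x
    using g_le[of z x] M cut_0[of M x] by (auto simp: w_def trunc_def indicator_def g_def)
  have gf: "AE x in lebesgue. (\<lambda>n. g M (h n x) x) \<longlonglongrightarrow> g M (f x) x"
    using h_AE
  proof eventually_elim
    case (elim x)
    then show ?case
      unfolding g_def using continuous_on_tendsto_compose[OF cont_clamp[OF M] elim]
      by (intro tendsto_intros) auto
  qed
  have gmeas: "(\<lambda>x. g M (h n x) x) \<in> borel_measurable lebesgue" "(\<lambda>x. g M (f x) x) \<in> borel_measurable lebesgue" for n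
    unfolding g_def using M by measurable
  note conv = L2_dominated_convergence[OF gmeas w gf AE_I2, OF g_w]
  from order_tendstoD(2)[OF conv(3), of "e/2"] \<open>e > 0\<close>
  obtain n where n: "L2_norm (\<lambda>x. g M (h n x) x - g M (f x) x) < e / 2"
    by (auto dest: eventually_happens'[OF sequentially_bot])
  let ?g = "\<lambda>x. g M (h n x) x"
  show ?thesis
  proof (rule that)
    show "continuous_on UNIV ?g"
      unfolding g_def
      by (intro continuous_intros cont_cut continuous_on_compose2[OF cont_clamp[OF M] h]) auto
    show "?g \<in> L2_space" by (rule conv(2))
    have "L2_norm (\<lambda>x. ?g x - f x) \<le> L2_norm (\<lambda>x. ?g x - g M (f x) x) + L2_norm (\<lambda>x. g M (f x) x - f x)"
      by (intro L2_triangle_mid conv f)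
    also have "\<dots> < e" using m n by (simp add: M_def)
    finally show "L2_norm (\<lambda>x. f x - ?g x) < e"
      by (simp add: L2_norm_minus_commute)
    show "cmod (?g x) \<le> M" for x by (rule g_le)
    show "?g x = 0" if "norm x > M + 1" for x
      using cut_0[OF that] by (simp add: g_def)
  qed
qed

section \<open>Gaussians\<close>

lemma
  fixes h :: "'a::euclidean_space \<Rightarrow> real \<Rightarrow> complex"
  assumes h: "\<And>b. b \<in> Basis \<Longrightarrow> integrable lborel (h b)"
  shows integrable_lborel_prod: "integrable lborel (\<lambda>x. \<Prod>b\<in>Basis. h b (x \<bullet> b))"
    and integral_lborel_prod: "(LINT x|lborel. (\<Prod>b\<in>Basis. h b (x \<bullet> b))) = (\<Prod>b\<in>Basis. (LINT y|lborel. h b y))"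
proof -
  interpret product_sigma_finite "\<lambda>_::'a. lborel :: real measure" by standard
  have h_meas: "h b \<in> borel_measurable borel" if "b \<in> Basis" for b
    using borel_measurable_integrable[OF h[OF that]] by simp
  have meas: "(\<lambda>x::'a. \<Prod>b\<in>Basis. h b (x \<bullet> b)) \<in> borel_measurable borel"
    by (intro borel_measurable_prod measurable_compose[OF _ h_meas]) auto
  have T: "(\<lambda>f. \<Sum>b\<in>Basis. f b *\<^sub>R b) \<in> (\<Pi>\<^sub>M b\<in>(Basis::'a set). lborel) \<rightarrow>\<^sub>M (borel :: 'a measure)"
    by measurable
  have coord: "(\<Prod>b\<in>Basis. h b ((\<Sum>c\<in>Basis. f c *\<^sub>R c) \<bullet> b)) = (\<Prod>b\<in>Basis. h b (f b))" for f :: "'a \<Rightarrow> real"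
    by (intro prod.cong refl) (simp add: inner_sum_left_Basis)
  show "integrable lborel (\<lambda>x. \<Prod>b\<in>Basis. h b (x \<bullet> b))"
    unfolding lborel_eq[where 'a='a] integrable_distr_eq[OF T meas] coord
    by (rule product_integrable_prod) (use h in auto)
  show "(LINT x|lborel. (\<Prod>b\<in>Basis. h b (x \<bullet> b))) = (\<Prod>b\<in>Basis. (LINT y|lborel. h b y))"
    unfolding lborel_eq[where 'a='a] integral_distr[OF T meas] coord
    by (subst product_integral_prod) (use h in \<open>auto simp: lborel_eq[symmetric]\<close>)
qed

lemma gaussian_integrable_1d:
  assumes "d \<noteq> 0"
  shows "integrable lborel (\<lambda>x::real. complex_of_real (exp (- (d * x)\<^sup>2 / 2)) * exp (\<i> * complex_of_real (t * x)))"
proof -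
  have "integrable lborel (\<lambda>x::real. exp (- x\<^sup>2 / 2))"
    using integrable_mult_right[OF integrable_normal_density[of 1 0], of "sqrt (2 * pi)"]
    by (simp add: normal_density_def)
  from lborel_integrable_real_affine[OF this, of d 0] assms
  have "integrable lborel (\<lambda>x. exp (- (d * x)\<^sup>2 / 2))" by simp
  then show ?thesis
    by (rule Bochner_Integration.integrable_bound) (auto simp: norm_mult)
qed

text \<open>The characteristic function of the standard normal distribution, rescaled.\<close>

lemma gaussian_fourier_1d:
  assumes "d > 0"
  shows "(LINT x|lborel. complex_of_real (exp (- (d * x)\<^sup>2 / 2)) * exp (\<i> * complex_of_real (t * x)))
     = complex_of_real (sqrt (2 * pi) / d * exp (- (t / d)\<^sup>2 / 2))"
proof -
  have std: "(LINT x|lborel. complex_of_real (exp (- x\<^sup>2 / 2)) * exp (\<i> * complex_of_real (s * x)))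
     = complex_of_real (sqrt (2 * pi) * exp (- s\<^sup>2 / 2))" for s
  proof -
    have "complex_of_real (exp (- s\<^sup>2 / 2)) = char std_normal_distribution s"
      by (simp add: char_std_normal_distribution)
    also have "\<dots> = (LINT x|lborel. std_normal_density x *\<^sub>R iexp (s * x))"
      unfolding char_def by (subst integral_density) (auto simp: normal_density_nonneg)
    also have "\<dots> = (LINT x|lborel. complex_of_real (1 / sqrt (2 * pi)) *
        (complex_of_real (exp (- x\<^sup>2 / 2)) * exp (\<i> * complex_of_real (s * x))))"
      by (simp add: std_normal_density_def scaleR_conv_of_real)
    also have "\<dots> = complex_of_real (1 / sqrt (2 * pi)) *
        (LINT x|lborel. complex_of_real (exp (- x\<^sup>2 / 2)) * exp (\<i> * complex_of_real (s * x)))"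
      by simp
    finally show ?thesis
      by (simp add: field_simps)
  qed
  have "complex_of_real (sqrt (2 * pi) * exp (- (t / d)\<^sup>2 / 2))
      = d *\<^sub>R (LINT x|lborel. complex_of_real (exp (- (d * x)\<^sup>2 / 2)) * exp (\<i> * complex_of_real (t * x)))"
    unfolding std[symmetric] using assms
    by (subst lborel_integral_real_affine[where c=d and t=0]) auto
  then show ?thesis
    using assms by (simp add: scaleR_conv_of_real field_simps)
qed

lemma
  fixes t :: "'a::euclidean_space"
  assumes "d > 0"
  shows gaussian_integrable: "integrable lebesgue (\<lambda>x::'a. complex_of_real (exp (- (d * norm x)\<^sup>2 / 2)) * exp (\<i> * complex_of_real (t \<bullet> x)))"
    and gaussian_fourier: "(LINT x|lebesgue. complex_of_real (exp (- (d * norm x)\<^sup>2 / 2)) * exp (\<i> * complex_of_real (t \<bullet> x)))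
     = complex_of_real ((sqrt (2 * pi) / d) ^ DIM('a) * exp (- (norm t / d)\<^sup>2 / 2))"
proof -
  let ?g = "\<lambda>x::'a. complex_of_real (exp (- (d * norm x)\<^sup>2 / 2)) * exp (\<i> * complex_of_real (t \<bullet> x))"
  let ?h = "\<lambda>b y. complex_of_real (exp (- (d * y)\<^sup>2 / 2)) * exp (\<i> * complex_of_real ((t \<bullet> b) * y))"
  have norm_sq: "(c * norm x)\<^sup>2 = (\<Sum>b\<in>Basis. (c * (x \<bullet> b))\<^sup>2)" for x :: 'a and c
    by (simp add: power_mult_distrib norm_eq_sqrt_inner euclidean_inner[of x x] power2_eq_square
        sum_distrib_left sum_nonneg real_sqrt_mult_self mult_ac)
  have g_eq: "?g x = (\<Prod>b\<in>Basis. ?h b (x \<bullet> b))" for x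
    unfolding norm_sq euclidean_inner[of t x]
    by (simp add: prod.distrib exp_sum[symmetric] sum_distrib_left sum_negf sum_divide_distrib of_real_prod[symmetric] del: of_real_prod)
  have meas: "?g \<in> borel_measurable lborel"
    by measurable
  have "integrable lborel ?g"
    unfolding g_eq using gaussian_integrable_1d assms by (intro integrable_lborel_prod) auto
  then show "integrable lebesgue ?g"
    using integrable_completion[OF meas] by simp
  have "(LINT x|lebesgue. ?g x) = (LINT x|lborel. ?g x)"
    by (rule integral_completion[OF meas])
  also have "\<dots> = (\<Prod>b\<in>Basis. (LINT y|lborel. ?h b y))"
    unfolding g_eq using gaussian_integrable_1d assms by (intro integral_lborel_prod) auto
  also have "\<dots> = (\<Prod>b\<in>Basis. complex_of_real (sqrt (2 * pi) / d * exp (- ((t \<bullet> b) / d)\<^sup>2 / 2)))"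
    using gaussian_fourier_1d[OF assms] by simp
  also have "\<dots> = complex_of_real ((\<Prod>b\<in>(Basis::'a set). sqrt (2 * pi) / d) * (\<Prod>b\<in>Basis. exp (- ((t \<bullet> b) / d)\<^sup>2 / 2)))"
    unfolding of_real_prod[symmetric] prod.distrib ..
  also have "(\<Prod>b\<in>Basis. exp (- ((t \<bullet> b) / d)\<^sup>2 / 2)) = exp (- (norm t / d)\<^sup>2 / 2)"
    using norm_sq[of "1 / d" t] by (simp add: exp_sum[symmetric] sum_negf sum_divide_distrib)
  also have "(\<Prod>b\<in>(Basis::'a set). sqrt (2 * pi) / d) = (sqrt (2 * pi) / d) ^ DIM('a)"
    by simp
  finally show "(LINT x|lebesgue. ?g x) = complex_of_real ((sqrt (2 * pi) / d) ^ DIM('a) * exp (- (norm t / d)\<^sup>2 / 2))" .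
qed

section \<open>The Fourier integral and its Gaussian regularisation\<close>

lemma sigma_finite_lebesgue: "sigma_finite_measure (lebesgue :: 'a::euclidean_space measure)"
proof
  obtain A :: "'a set set" where A: "countable A" "A \<subseteq> sets lborel" "\<Union>A = space lborel"
    "\<forall>a\<in>A. emeasure lborel a \<noteq> \<infinity>"
    using sigma_finite_measure.sigma_finite_countable[OF sigma_finite_lborel] by blast
  then show "\<exists>A::'a set set. countable A \<and> A \<subseteq> sets lebesgue \<and> \<Union>A = space lebesgue \<and> (\<forall>a\<in>A. emeasure lebesgue a \<noteq> \<infinity>)"
    by (intro exI[of _ A]) (auto simp: subset_iff)
qed

text \<open>With this, Fubini's theorem applies to the completed measure directly, and representatives
  need not be replaced by Borel functions.\<close>

interpretation lebesgue: sigma_finite_measure "lebesgue :: 'a::euclidean_space measure"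
  by (rule sigma_finite_lebesgue)

interpretation lebesgue_pair: pair_sigma_finite
    "lebesgue :: 'a::euclidean_space measure" "lebesgue :: 'b::euclidean_space measure" ..

lemma ident_lebesgue_borel: "(\<lambda>x. x) \<in> borel_measurable lebesgue"
  by (simp add: measurable_completion)

lemma fst_lebesgue_borel [measurable]:
  "fst \<in> borel_measurable ((lebesgue :: 'a::euclidean_space measure) \<Otimes>\<^sub>M N)"
  by (rule measurable_compose[OF measurable_fst ident_lebesgue_borel])

lemma snd_lebesgue_borel [measurable]:
  "snd \<in> borel_measurable (N \<Otimes>\<^sub>M (lebesgue :: 'a::euclidean_space measure))"
  by (rule measurable_compose[OF measurable_snd ident_lebesgue_borel])

lemma borel_imp_lebesgue_measurable: "f \<in> borel_measurable borel \<Longrightarrow> f \<in> borel_measurable lebesgue"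
  by (simp add: measurable_completion)

abbreviation character :: "'a::euclidean_space \<Rightarrow> 'a \<Rightarrow> complex" where
  "character x \<xi> \<equiv> exp (- (\<i> * complex_of_real (x \<bullet> \<xi>)))"

lemma norm_character [simp]: "cmod (character x \<xi>) = 1"
  using norm_exp_i_times[of "- (x \<bullet> \<xi>)"] by simp

definition FT :: "('a::euclidean_space \<Rightarrow> complex) \<Rightarrow> 'a \<Rightarrow> complex" where
  "FT f \<xi> = (LINT x|lebesgue. f x * character x \<xi>)"

lemma FT_integrable:
  assumes "integrable lebesgue f"
  shows "integrable lebesgue (\<lambda>x. f x * character x \<xi>)"
proof (rule Bochner_Integration.integrable_bound[OF assms])
  note [measurable] = borel_measurable_integrable[OF assms] ident_lebesgue_borel
  show "(\<lambda>x. f x * character x \<xi>) \<in> borel_measurable lebesgue"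
    by measurable
qed (simp add: norm_mult)

lemma FT_measurable:
  assumes "integrable lebesgue f"
  shows "FT f \<in> borel_measurable lebesgue"
proof -
  note [measurable] = borel_measurable_integrable[OF assms]
  show ?thesis
    unfolding FT_def
    by (intro lebesgue.borel_measurable_lebesgue_integral) measurable
qed

lemma FT_bound: "cmod (FT f \<xi>) \<le> (LINT x|lebesgue. cmod (f x))"
  unfolding FT_def using integral_norm_bound[of lebesgue "\<lambda>x. f x * character x \<xi>"]
  by (simp add: norm_mult)

lemma FT_diff:
  assumes "integrable lebesgue f" "integrable lebesgue g"
  shows "FT (\<lambda>x. f x - g x) \<xi> = FT f \<xi> - FT g \<xi>"
  unfolding FT_def
  by (subst Bochner_Integration.integral_diff[symmetric])
     (auto intro!: FT_integrable assms simp: left_diff_distrib)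

lemma FT_mult_integrable:
  assumes f: "integrable lebesgue f" and u: "integrable lebesgue u"
  shows "integrable lebesgue (\<lambda>\<xi>. FT f \<xi> * u \<xi>)"
proof (rule Bochner_Integration.integrable_bound)
  note [measurable] = FT_measurable[OF f] borel_measurable_integrable[OF u]
  show "(\<lambda>\<xi>. FT f \<xi> * u \<xi>) \<in> borel_measurable lebesgue" by measurable
  show "integrable lebesgue (\<lambda>\<xi>. (LINT x|lebesgue. cmod (f x)) * cmod (u \<xi>))"
    by (intro integrable_mult_right integrable_norm u)
  show "AE \<xi> in lebesgue. norm (FT f \<xi> * u \<xi>) \<le> norm ((LINT x|lebesgue. cmod (f x)) * cmod (u \<xi>))"
    by (auto simp: norm_mult abs_mult intro!: mult_right_mono order_trans[OF FT_bound])
qed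

text \<open>Both sides are the double integral of \<open>f x * u \<xi> * exp (- i x \<bullet> \<xi>)\<close>.\<close>

lemma FT_multiplication_formula:
  fixes f u :: "'a::euclidean_space \<Rightarrow> complex"
  assumes f: "integrable lebesgue f" and u: "integrable lebesgue u"
  shows "(LINT \<xi>|lebesgue. FT f \<xi> * u \<xi>) = (LINT x|lebesgue. f x * FT u x)"
proof -
  note [measurable] = borel_measurable_integrable[OF u] borel_measurable_integrable[OF f]
  let ?k = "\<lambda>x \<xi>. f x * (u \<xi> * character x \<xi>)"
  have "integrable (lebesgue \<Otimes>\<^sub>M lebesgue) (case_prod ?k)"
  proof (rule lebesgue_pair.Fubini_integrable)
    show "case_prod ?k \<in> borel_measurable (lebesgue \<Otimes>\<^sub>M lebesgue)"
      by measurable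
    show "integrable lebesgue (\<lambda>x. LINT \<xi>|lebesgue. norm (case (x, \<xi>) of (x, \<xi>) \<Rightarrow> ?k x \<xi>))"
      by (simp add: norm_mult) (intro disjI2 integrable_norm f)
    have "integrable lebesgue (\<lambda>\<xi>. ?k x \<xi>)" for x
      using FT_integrable[OF u, of x] by (simp add: inner_commute)
    then show "AE x in lebesgue. integrable lebesgue (\<lambda>\<xi>. case (x, \<xi>) of (x, \<xi>) \<Rightarrow> ?k x \<xi>)"
      by simp
  qed
  from lebesgue_pair.Fubini_integral[OF this]
  have "(LINT \<xi>|lebesgue. LINT x|lebesgue. ?k x \<xi>) = (LINT x|lebesgue. LINT \<xi>|lebesgue. ?k x \<xi>)" .
  also have "(\<lambda>\<xi>. LINT x|lebesgue. ?k x \<xi>) = (\<lambda>\<xi>. FT f \<xi> * u \<xi>)"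
  proof
    fix \<xi>
    have "(\<lambda>x. ?k x \<xi>) = (\<lambda>x. (f x * character x \<xi>) * u \<xi>)"
      by (simp add: mult_ac)
    then show "(LINT x|lebesgue. ?k x \<xi>) = FT f \<xi> * u \<xi>"
      by (simp add: FT_def)
  qed
  also have "(\<lambda>x. LINT \<xi>|lebesgue. ?k x \<xi>) = (\<lambda>x. f x * FT u x)"
    by (simp add: FT_def inner_commute)
  finally show ?thesis .
qed

text \<open>The centred Gaussian probability density with standard deviation \<open>d\<close> in each coordinate; up
  to the factor \<open>(2 \<pi>)^n\<close> it is the Fourier transform of the weight \<open>exp (- d\<^sup>2 |\<xi>|\<^sup>2 / 2)\<close>.\<close>

definition heat :: "real \<Rightarrow> 'a::euclidean_space \<Rightarrow> real" where
  "heat d z = (1 / (sqrt (2 * pi) * d)) ^ DIM('a) * exp (- (norm z / d)\<^sup>2 / 2)"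

lemma heat_nonneg [simp]: "d > 0 \<Longrightarrow> heat d z \<ge> 0"
  by (simp add: heat_def)

lemma heat_measurable [measurable]: "heat d \<in> borel_measurable borel"
  unfolding heat_def by measurable

lemma heat_integral:
  assumes "d > 0"
  shows "integrable lebesgue (heat d :: 'a::euclidean_space \<Rightarrow> real)"
    and "(LINT z|lebesgue. heat d (z::'a)) = 1"
proof -
  let ?E = "\<lambda>z::'a. exp (- ((1 / d) * norm z)\<^sup>2 / 2)"
  have int: "integrable lebesgue (\<lambda>z. complex_of_real (?E z))"
    using gaussian_integrable[of "1 / d" "0::'a"] assms by simp
  then have intE: "integrable lebesgue ?E"
    by (simp only: complex_of_real_integrable_eq)
  have "complex_of_real (LINT z|lebesgue. ?E z) = complex_of_real ((sqrt (2 * pi) / (1 / d)) ^ DIM('a))"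
    using gaussian_fourier[of "1 / d" "0::'a"] assms by (simp only: integral_complex_of_real[symmetric]) simp
  then have E: "(LINT z|lebesgue. ?E z) = (sqrt (2 * pi) / (1 / d)) ^ DIM('a)"
    by (simp only: of_real_eq_iff)
  have heat: "heat d = (\<lambda>z::'a. (1 / (sqrt (2 * pi) * d)) ^ DIM('a) * ?E z)"
    by (simp add: heat_def fun_eq_iff)
  show "integrable lebesgue (heat d :: 'a \<Rightarrow> real)"
    unfolding heat by (intro integrable_mult_right intE)
  show "(LINT z|lebesgue. heat d (z::'a)) = 1"
    unfolding heat integral_mult_right_zero E using assms
    by (simp add: power_mult_distrib[symmetric])
qed

lemma heat_translate:
  fixes x :: "'a::euclidean_space"
  assumes "d > 0"
  shows "(\<integral>\<^sup>+y. ennreal (heat d (y - x)) \<partial>lebesgue) = 1" and "(\<integral>\<^sup>+y. ennreal (heat d (x - y)) \<partial>lebesgue) = 1"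
proof -
  have "(\<integral>\<^sup>+y. ennreal (heat d (y - x)) \<partial>lebesgue) = (\<integral>\<^sup>+y. ennreal (heat d (y - x)) \<partial>distr lborel borel ((+) x))"
    by (simp only: nn_integral_completion lborel_distr_plus)
  also have "\<dots> = (\<integral>\<^sup>+y. ennreal (heat d (y::'a)) \<partial>lborel)"
    by (subst nn_integral_distr) auto
  also have "\<dots> = (\<integral>\<^sup>+y. ennreal (heat d (y::'a)) \<partial>lebesgue)"
    by (simp only: nn_integral_completion)
  also have "\<dots> = 1"
    using heat_integral[OF assms, where 'a='a] assms
    by (subst nn_integral_eq_integral) auto
  finally show 1: "(\<integral>\<^sup>+y. ennreal (heat d (y - x)) \<partial>lebesgue) = 1" .
  have "heat d (x - y) = heat d (y - x)" for y
    by (simp add: heat_def norm_minus_commute)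
  then show "(\<integral>\<^sup>+y. ennreal (heat d (x - y)) \<partial>lebesgue) = 1"
    using 1 by simp
qed

text \<open>Two applications of the multiplication formula. The first moves the transform from \<open>f\<close> to the
  integrable function \<open>cnj (FT f) * w\<close>; the second computes the transform of that function, in
  which only the transform of a modulated Gaussian remains.\<close>

lemma FT_gaussian_weight:
  fixes f :: "'a::euclidean_space \<Rightarrow> complex"
  assumes f: "integrable lebesgue f" and d: "d > 0"
  defines "w \<equiv> \<lambda>\<xi>::'a. complex_of_real (exp (- (d * norm \<xi>)\<^sup>2 / 2))"
  shows "(LINT \<xi>|lebesgue. FT f \<xi> * (cnj (FT f \<xi>) * w \<xi>))
     = (LINT x|lebesgue. f x * cnj (complex_of_real ((2 * pi) ^ DIM('a)) *
          (LINT y|lebesgue. f y * complex_of_real (heat d (x - y)))))"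
proof -
  note [measurable] = FT_measurable[OF f]
  have w_int: "integrable lebesgue (\<lambda>\<xi>. w \<xi> * exp (\<i> * complex_of_real (x \<bullet> \<xi>)))" for x
    unfolding w_def by (rule gaussian_integrable[OF d])
  have w_int0: "integrable lebesgue w"
    using w_int[of 0] by simp
  let ?u = "\<lambda>\<xi>. cnj (FT f \<xi>) * w \<xi>"
  have cnj_w: "cnj (w \<xi>) = w \<xi>" for \<xi>
    by (simp add: w_def)
  have cnj_u: "cnj (?u \<xi> * character \<xi> x) = FT f \<xi> * (w \<xi> * exp (\<i> * complex_of_real (x \<bullet> \<xi>)))" for \<xi> x
    by (simp add: cnj_w exp_cnj inner_commute mult_ac)
  have u_int: "integrable lebesgue ?u"
  proof -
    have "integrable lebesgue (\<lambda>\<xi>. cnj (FT f \<xi> * w \<xi>))"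
      unfolding complex_integrable_cnj by (rule FT_mult_integrable[OF f w_int0])
    then show ?thesis by (simp add: cnj_w)
  qed
  have FT_u: "FT ?u x = cnj (complex_of_real ((2 * pi) ^ DIM('a)) *
          (LINT y|lebesgue. f y * complex_of_real (heat d (x - y))))" for x
  proof -
    have "cnj (FT ?u x) = (LINT \<xi>|lebesgue. FT f \<xi> * (w \<xi> * exp (\<i> * complex_of_real (x \<bullet> \<xi>))))"
      unfolding FT_def[of ?u] Bochner_Integration.integral_cnj[symmetric] cnj_u ..
    also have "\<dots> = (LINT y|lebesgue. f y * FT (\<lambda>\<xi>. w \<xi> * exp (\<i> * complex_of_real (x \<bullet> \<xi>))) y)"
      by (rule FT_multiplication_formula[OF f w_int])
    also have "(\<lambda>y. FT (\<lambda>\<xi>. w \<xi> * exp (\<i> * complex_of_real (x \<bullet> \<xi>))) y)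
        = (\<lambda>y. complex_of_real ((2 * pi) ^ DIM('a) * heat d (x - y)))"
    proof
      fix y
      have "FT (\<lambda>\<xi>. w \<xi> * exp (\<i> * complex_of_real (x \<bullet> \<xi>))) y
          = (LINT \<xi>|lebesgue. w \<xi> * exp (\<i> * complex_of_real ((x - y) \<bullet> \<xi>)))"
        unfolding FT_def mult.assoc exp_add[symmetric]
        by (simp add: inner_diff_left inner_commute algebra_simps)
      also have "\<dots> = complex_of_real ((sqrt (2 * pi) / d) ^ DIM('a) * exp (- (norm (x - y) / d)\<^sup>2 / 2))"
        unfolding w_def by (rule gaussian_fourier[OF d])
      also have "(sqrt (2 * pi) / d) ^ DIM('a) = (2 * pi) ^ DIM('a) * (1 / (sqrt (2 * pi) * d)) ^ DIM('a)"
      proof -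
        have cancel: "s / d = s * s * (1 / (s * d))" if "s > 0" for s :: real
          using that d by (simp add: field_simps)
        have "sqrt (2 * pi) / d = sqrt (2 * pi) * sqrt (2 * pi) * (1 / (sqrt (2 * pi) * d))"
          by (rule cancel) simp
        also have "\<dots> = (2 * pi) * (1 / (sqrt (2 * pi) * d))"
          by (subst real_sqrt_mult_self) simp
        finally show ?thesis
          by (simp only: power_mult_distrib)
      qed
      finally show "FT (\<lambda>\<xi>. w \<xi> * exp (\<i> * complex_of_real (x \<bullet> \<xi>))) y
          = complex_of_real ((2 * pi) ^ DIM('a) * heat d (x - y))"
        by (simp add: heat_def mult.assoc)
    qed
    also have "(LINT y|lebesgue. f y * complex_of_real ((2 * pi) ^ DIM('a) * heat d (x - y)))
        = complex_of_real ((2 * pi) ^ DIM('a)) * (LINT y|lebesgue. f y * complex_of_real (heat d (x - y)))"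
      unfolding integral_mult_right_zero[symmetric] by (simp add: mult_ac)
    finally have "cnj (FT ?u x) = complex_of_real ((2 * pi) ^ DIM('a)) * (LINT y|lebesgue. f y * complex_of_real (heat d (x - y)))" .
    then show ?thesis
      by (metis complex_cnj_cnj)
  qed
  show ?thesis
    unfolding FT_multiplication_formula[OF f u_int] FT_u ..
qed

text \<open>Bound the product \<open>|f x| |f y|\<close> by half the sum of the squares; in each half one variable
  integrates out, since the kernel has total mass one in either variable.\<close>

lemma heat_quadratic_form_bound:
  fixes f :: "'a::euclidean_space \<Rightarrow> complex"
  assumes f: "f \<in> L2_space" and d: "d > 0"
  shows "(\<integral>\<^sup>+x. ennreal (cmod (f x)) * (\<integral>\<^sup>+y. ennreal (cmod (f y)) * ennreal (heat d (x - y)) \<partial>lebesgue) \<partial>lebesgue)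
    \<le> ennreal ((L2_norm f)\<^sup>2)"
proof -
  note [measurable] = L2_measurable[OF f]
  let ?h = "\<lambda>x y. ennreal (heat d (x - y :: 'a))"
  let ?q = "\<lambda>x. ennreal ((cmod (f x))\<^sup>2 / 2)"
  have q_int: "(\<integral>\<^sup>+x. ?q x \<partial>lebesgue) = ennreal ((L2_norm f)\<^sup>2 / 2)"
    using nn_integral_eq_integral[of lebesgue "\<lambda>x. (cmod (f x))\<^sup>2 / 2"] L2_integrable_sq[OF f]
    by (simp add: L2_norm_sq)
  have am_gm: "ennreal (cmod (f x)) * (ennreal (cmod (f y)) * ?h x y) \<le> ?q x * ?h x y + ?q y * ?h x y" for x y
  proof -
    have "cmod (f x) * cmod (f y) \<le> (cmod (f x))\<^sup>2 / 2 + (cmod (f y))\<^sup>2 / 2"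
      using sum_squares_bound[of "cmod (f x)" "cmod (f y)"] by simp
    then have "ennreal (cmod (f x)) * ennreal (cmod (f y)) \<le> ?q x + ?q y"
      by (simp add: ennreal_mult'[symmetric] ennreal_plus[symmetric] ennreal_leI del: ennreal_plus)
    from mult_right_mono[OF this, of "?h x y"] show ?thesis
      by (simp add: distrib_right mult.assoc)
  qed
  have "(\<integral>\<^sup>+x. ennreal (cmod (f x)) * (\<integral>\<^sup>+y. ennreal (cmod (f y)) * ?h x y \<partial>lebesgue) \<partial>lebesgue)
      = (\<integral>\<^sup>+x. (\<integral>\<^sup>+y. ennreal (cmod (f x)) * (ennreal (cmod (f y)) * ?h x y) \<partial>lebesgue) \<partial>lebesgue)"
    by (intro nn_integral_cong nn_integral_cmult[symmetric]) (use ident_lebesgue_borel in measurable)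
  also have "\<dots> \<le> (\<integral>\<^sup>+x. (\<integral>\<^sup>+y. ?q x * ?h x y + ?q y * ?h x y \<partial>lebesgue) \<partial>lebesgue)"
    by (intro nn_integral_mono am_gm)
  also have "\<dots> = (\<integral>\<^sup>+x. (\<integral>\<^sup>+y. ?q x * ?h x y \<partial>lebesgue) + (\<integral>\<^sup>+y. ?q y * ?h x y \<partial>lebesgue) \<partial>lebesgue)"
    by (intro nn_integral_cong nn_integral_add) (use ident_lebesgue_borel in measurable)
  also have "\<dots> = (\<integral>\<^sup>+x. (\<integral>\<^sup>+y. ?q x * ?h x y \<partial>lebesgue) \<partial>lebesgue) + (\<integral>\<^sup>+x. (\<integral>\<^sup>+y. ?q y * ?h x y \<partial>lebesgue) \<partial>lebesgue)"
    by (intro nn_integral_add lebesgue.borel_measurable_nn_integral) measurable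
  also have "(\<integral>\<^sup>+x. (\<integral>\<^sup>+y. ?q y * ?h x y \<partial>lebesgue) \<partial>lebesgue) = (\<integral>\<^sup>+y. (\<integral>\<^sup>+x. ?q y * ?h x y \<partial>lebesgue) \<partial>lebesgue)"
    by (rule lebesgue_pair.Fubini') measurable
  also have "(\<lambda>y. \<integral>\<^sup>+x. ?q y * ?h x y \<partial>lebesgue) = ?q"
  proof
    fix y
    have "(\<lambda>x. ?h x y) \<in> borel_measurable lebesgue"
      by (intro borel_imp_lebesgue_measurable) measurable
    then show "(\<integral>\<^sup>+x. ?q y * ?h x y \<partial>lebesgue) = ?q y"
      by (simp add: nn_integral_cmult heat_translate[OF d])
  qed
  also have "(\<lambda>x. \<integral>\<^sup>+y. ?q x * ?h x y \<partial>lebesgue) = ?q"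
  proof
    fix x
    have "(\<lambda>y. ?h x y) \<in> borel_measurable lebesgue"
      by (intro borel_imp_lebesgue_measurable) measurable
    then show "(\<integral>\<^sup>+y. ?q x * ?h x y \<partial>lebesgue) = ?q x"
      by (simp add: nn_integral_cmult heat_translate[OF d])
  qed
  finally show ?thesis
    by (simp add: q_int ennreal_plus[symmetric] del: ennreal_plus)
qed

lemma norm_integral_le_nn_integral: "ennreal (norm (integral\<^sup>L M f)) \<le> (\<integral>\<^sup>+x. ennreal (norm (f x)) \<partial>M)"
  by (cases "integrable M f") (auto intro: integral_norm_bound_ennreal simp: not_integrable_integral_eq)

lemma FT_weighted_energy:
  fixes f :: "'a::euclidean_space \<Rightarrow> complex"
  assumes f: "f \<in> L2_space" and fi: "integrable lebesgue f" and d: "d > 0"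
  shows "(\<integral>\<^sup>+\<xi>. ennreal ((cmod (FT f \<xi>))\<^sup>2 * exp (- (d * norm \<xi>)\<^sup>2 / 2)) \<partial>lebesgue)
     \<le> ennreal ((2 * pi) ^ DIM('a) * (L2_norm f)\<^sup>2)"
proof -
  let ?w = "\<lambda>\<xi>::'a. exp (- (d * norm \<xi>)\<^sup>2 / 2)"
  let ?c = "(2 * pi) ^ DIM('a)"
  let ?H = "\<lambda>x. LINT y|lebesgue. f y * complex_of_real (heat d (x - y))"
  note [measurable] = L2_measurable[OF f]
  have w_int: "integrable lebesgue (\<lambda>\<xi>. complex_of_real (?w \<xi>))"
    using gaussian_integrable[OF d, of 0] by simp
  have eq: "FT f \<xi> * (cnj (FT f \<xi>) * complex_of_real (?w \<xi>)) = complex_of_real ((cmod (FT f \<xi>))\<^sup>2 * ?w \<xi>)" for \<xi>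
    by (simp only: mult.assoc[symmetric] complex_norm_square[symmetric] of_real_mult)
  have "integrable lebesgue (\<lambda>\<xi>. complex_of_real ((cmod (FT f \<xi>))\<^sup>2 * ?w \<xi>))"
  proof -
    have "integrable lebesgue (\<lambda>\<xi>. cnj (FT f \<xi> * complex_of_real (?w \<xi>)))"
      unfolding complex_integrable_cnj by (rule FT_mult_integrable[OF fi w_int])
    then have "integrable lebesgue (\<lambda>\<xi>. FT f \<xi> * (cnj (FT f \<xi>) * complex_of_real (?w \<xi>)))"
      by (intro FT_mult_integrable[OF fi]) simp
    then show ?thesis by (simp only: eq)
  qed
  then have int: "integrable lebesgue (\<lambda>\<xi>. (cmod (FT f \<xi>))\<^sup>2 * ?w \<xi>)"
    by (simp only: complex_of_real_integrable_eq)
  have "(\<integral>\<^sup>+\<xi>. ennreal ((cmod (FT f \<xi>))\<^sup>2 * ?w \<xi>) \<partial>lebesgue)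
      = ennreal (LINT \<xi>|lebesgue. (cmod (FT f \<xi>))\<^sup>2 * ?w \<xi>)"
    by (rule nn_integral_eq_integral[OF int]) simp
  also have "\<dots> = ennreal (cmod (LINT \<xi>|lebesgue. complex_of_real ((cmod (FT f \<xi>))\<^sup>2 * ?w \<xi>)))"
    unfolding integral_complex_of_real norm_of_real
    by (subst abs_of_nonneg) (auto intro!: integral_nonneg_AE)
  also have "\<dots> = ennreal (cmod (LINT x|lebesgue. f x * cnj (complex_of_real ?c * ?H x)))"
    unfolding eq[symmetric] FT_gaussian_weight[OF fi d] ..
  also have "\<dots> \<le> (\<integral>\<^sup>+x. ennreal (cmod (f x * cnj (complex_of_real ?c * ?H x))) \<partial>lebesgue)"
    by (rule norm_integral_le_nn_integral)
  also have "\<dots> \<le> (\<integral>\<^sup>+x. ennreal ?c * (ennreal (cmod (f x)) * (\<integral>\<^sup>+y. ennreal (cmod (f y)) * ennreal (heat d (x - y)) \<partial>lebesgue)) \<partial>lebesgue)"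
  proof (rule nn_integral_mono)
    fix x
    have "ennreal (cmod (?H x)) \<le> (\<integral>\<^sup>+y. ennreal (cmod (f y)) * ennreal (heat d (x - y)) \<partial>lebesgue)"
      using norm_integral_le_nn_integral[of lebesgue "\<lambda>y. f y * complex_of_real (heat d (x - y))"] d
      by (simp add: norm_mult ennreal_mult)
    then have "ennreal ?c * (ennreal (cmod (f x)) * ennreal (cmod (?H x)))
       \<le> ennreal ?c * (ennreal (cmod (f x)) * (\<integral>\<^sup>+y. ennreal (cmod (f y)) * ennreal (heat d (x - y)) \<partial>lebesgue))"
      by (intro mult_left_mono) auto
    then show "ennreal (cmod (f x * cnj (complex_of_real ?c * ?H x)))
       \<le> ennreal ?c * (ennreal (cmod (f x)) * (\<integral>\<^sup>+y. ennreal (cmod (f y)) * ennreal (heat d (x - y)) \<partial>lebesgue))"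
      by (simp add: norm_mult ennreal_mult norm_power mult_ac)
  qed
  also have "\<dots> = ennreal ?c * (\<integral>\<^sup>+x. ennreal (cmod (f x)) * (\<integral>\<^sup>+y. ennreal (cmod (f y)) * ennreal (heat d (x - y)) \<partial>lebesgue) \<partial>lebesgue)"
    by (intro nn_integral_cmult borel_measurable_times lebesgue.borel_measurable_nn_integral) measurable
  also have "\<dots> \<le> ennreal ?c * ennreal ((L2_norm f)\<^sup>2)"
    by (intro mult_left_mono heat_quadratic_form_bound[OF f d]) simp
  also have "\<dots> = ennreal (?c * (L2_norm f)\<^sup>2)"
    by (simp add: ennreal_mult)
  finally show ?thesis .
qed

lemma gaussian_weight_tendsto:
  "(\<lambda>k. exp (- (inverse (real (Suc k)) * r)\<^sup>2 / 2)) \<longlonglongrightarrow> 1"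
proof -
  have "(\<lambda>k. exp (- (inverse (real (Suc k)) * r)\<^sup>2 / 2)) \<longlonglongrightarrow> exp (- (0 * r)\<^sup>2 / 2)"
    by (intro tendsto_intros LIMSEQ_inverse_real_of_nat) auto
  then show ?thesis by simp
qed

text \<open>The factor \<open>(2 \<pi>)^(n/2)\<close>. The dimension enters through the type alone, hence the argument.\<close>

definition plancherel_const :: "'a::euclidean_space itself \<Rightarrow> real" where
  "plancherel_const _ = sqrt ((2 * pi) ^ DIM('a))"

lemma plancherel_const_pos: "plancherel_const TYPE('a::euclidean_space) > 0"
  by (simp add: plancherel_const_def)

lemma plancherel_const_sq: "(plancherel_const TYPE('a::euclidean_space))\<^sup>2 = (2 * pi) ^ DIM('a)"
  by (simp add: plancherel_const_def)

text \<open>The bound on the weighted energy is uniform in the scale of the weight; Fatou's lemma removes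
  the weight.\<close>

lemma FT_Bessel:
  fixes f :: "'a::euclidean_space \<Rightarrow> complex"
  assumes f: "f \<in> L2_space" and fi: "integrable lebesgue f"
  shows "FT f \<in> L2_space" and "L2_norm (FT f) \<le> plancherel_const TYPE('a) * L2_norm f"
proof -
  note [measurable] = FT_measurable[OF fi] ident_lebesgue_borel
  let ?C = "plancherel_const TYPE('a) * L2_norm f"
  let ?w = "\<lambda>k \<xi>::'a. exp (- (inverse (real (Suc k)) * norm \<xi>)\<^sup>2 / 2)"
  have "(\<integral>\<^sup>+\<xi>. ennreal ((cmod (FT f \<xi>))\<^sup>2) \<partial>lebesgue)
      = (\<integral>\<^sup>+\<xi>. liminf (\<lambda>k. ennreal ((cmod (FT f \<xi>))\<^sup>2 * ?w k \<xi>)) \<partial>lebesgue)"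
  proof (rule nn_integral_cong)
    fix \<xi> :: 'a
    have "(\<lambda>k. ennreal ((cmod (FT f \<xi>))\<^sup>2 * ?w k \<xi>)) \<longlonglongrightarrow> ennreal ((cmod (FT f \<xi>))\<^sup>2 * 1)"
      by (intro tendsto_intros gaussian_weight_tendsto)
    from lim_imp_Liminf[OF sequentially_bot this]
    show "ennreal ((cmod (FT f \<xi>))\<^sup>2) = liminf (\<lambda>k. ennreal ((cmod (FT f \<xi>))\<^sup>2 * ?w k \<xi>))"
      by (simp only: mult_1_right)
  qed
  also have "\<dots> \<le> liminf (\<lambda>k. \<integral>\<^sup>+\<xi>. ennreal ((cmod (FT f \<xi>))\<^sup>2 * ?w k \<xi>) \<partial>lebesgue)"
    by (rule nn_integral_liminf) measurable
  also have "\<dots> \<le> ennreal (?C\<^sup>2)"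
  proof (rule Liminf_le)
    have "(\<integral>\<^sup>+\<xi>. ennreal ((cmod (FT f \<xi>))\<^sup>2 * ?w k \<xi>) \<partial>lebesgue) \<le> ennreal (?C\<^sup>2)" for k
      using FT_weighted_energy[OF f fi, of "inverse (real (Suc k))"]
      by (simp only: power_mult_distrib plancherel_const_sq) simp
    then show "\<forall>\<^sub>F k in sequentially. (\<integral>\<^sup>+\<xi>. ennreal ((cmod (FT f \<xi>))\<^sup>2 * ?w k \<xi>) \<partial>lebesgue) \<le> ennreal (?C\<^sup>2)"
      by simp
  qed simp
  finally have "(\<integral>\<^sup>+\<xi>. ennreal ((cmod (FT f \<xi>))\<^sup>2) \<partial>lebesgue) \<le> ennreal (?C\<^sup>2)" .
  then show "FT f \<in> L2_space" "L2_norm (FT f) \<le> ?C"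
    using L2_I_nn_integral[OF FT_measurable[OF fi]] plancherel_const_pos[where 'a='a]
    by (auto simp: less_imp_le)
qed

section \<open>Plancherel identity for integrable functions\<close>

lemma borel_measurable_cnj:
  "f \<in> borel_measurable M \<Longrightarrow> (\<lambda>x. cnj (f x)) \<in> borel_measurable M"
  by (rule measurable_compose[of f M borel])
     (auto intro!: borel_measurable_continuous_onI continuous_intros)

text \<open>After this substitution the kernel is independent of the scale, so that averages of a bounded
  continuous function converge pointwise by dominated convergence.\<close>

lemma heat_average_rescale:
  fixes g :: "'a::euclidean_space \<Rightarrow> complex"
  assumes g: "g \<in> borel_measurable borel" and d: "d > 0"
  shows "(LINT y|lebesgue. g y * complex_of_real (heat d (x - y)))
       = (LINT u|lebesgue. g (x + d *\<^sub>R u) * complex_of_real (heat 1 u))"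
proof -
  note [measurable] = g
  have jac: "\<bar>d\<bar> ^ DIM('a) * heat d (x - (x + d *\<^sub>R u)) = heat 1 u" for u
    using d by (simp add: heat_def power_divide power_mult_distrib)
  have "(LINT y|lebesgue. g y * complex_of_real (heat d (x - y)))
      = (LINT y|lborel. g y * complex_of_real (heat d (x - y)))"
    by (rule integral_completion) measurable
  also have "\<dots> = (LINT u|lborel. (\<bar>d\<bar> ^ DIM('a)) *\<^sub>R (g (x + d *\<^sub>R u) * complex_of_real (heat d (x - (x + d *\<^sub>R u)))))"
    using d by (subst lborel_affine[of d x])
      (simp_all add: integral_density integral_distr ennreal_power del: add_diff_cancel_left' diff_add_cancel)
  also have "\<dots> = (LINT u|lborel. g (x + d *\<^sub>R u) * complex_of_real (heat 1 u))"
    unfolding jac[symmetric] by (simp add: scaleR_conv_of_real mult_ac)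
  also have "\<dots> = (LINT u|lebesgue. g (x + d *\<^sub>R u) * complex_of_real (heat 1 u))"
    by (rule integral_completion[symmetric]) measurable
  finally show ?thesis .
qed

lemma heat_average_bound:
  fixes g :: "'a::euclidean_space \<Rightarrow> complex"
  assumes g: "\<And>x. cmod (g x) \<le> b" and d: "d > 0"
  shows "cmod (LINT y|lebesgue. g y * complex_of_real (heat d (x - y))) \<le> b"
proof -
  have b: "b \<ge> 0" using g[of 0] norm_ge_zero order_trans by blast
  have "ennreal (cmod (LINT y|lebesgue. g y * complex_of_real (heat d (x - y))))
      \<le> (\<integral>\<^sup>+y. ennreal (cmod (g y * complex_of_real (heat d (x - y)))) \<partial>lebesgue)"
    by (rule norm_integral_le_nn_integral)
  also have "\<dots> \<le> (\<integral>\<^sup>+y. ennreal b * ennreal (heat d (x - y)) \<partial>lebesgue)"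
    using g b d by (intro nn_integral_mono) (auto simp: norm_mult ennreal_mult[symmetric] intro!: ennreal_leI mult_right_mono)
  also have "\<dots> = ennreal b"
  proof -
    have "(\<lambda>y. ennreal (heat d (x - y))) \<in> borel_measurable lebesgue"
      by (intro borel_imp_lebesgue_measurable) measurable
    then show ?thesis
      by (simp add: nn_integral_cmult heat_translate[OF d])
  qed
  finally show ?thesis using b by simp
qed

lemma heat_average_tendsto:
  fixes g :: "'a::euclidean_space \<Rightarrow> complex"
  assumes g: "continuous_on UNIV g" and bound: "\<And>x. cmod (g x) \<le> b"
  shows "(\<lambda>k. LINT y|lebesgue. g y * complex_of_real (heat (inverse (real (Suc k))) (x - y))) \<longlonglongrightarrow> g x"
proof -
  have g_meas [measurable]: "g \<in> borel_measurable borel"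
    by (rule borel_measurable_continuous_onI[OF g])
  have b: "b \<ge> 0" using bound[of 0] norm_ge_zero order_trans by blast
  have "(\<lambda>k. LINT u|lebesgue. g (x + inverse (real (Suc k)) *\<^sub>R u) * complex_of_real (heat 1 u))
      \<longlonglongrightarrow> (LINT u|lebesgue. g x * complex_of_real (heat 1 (u :: 'a)))"
  proof (rule integral_dominated_convergence[where w="\<lambda>u. b * heat 1 u"])
    show "integrable lebesgue (\<lambda>u::'a. b * heat 1 u)"
      by (intro integrable_mult_right heat_integral) simp
    show "AE u in lebesgue. (\<lambda>k. g (x + inverse (real (Suc k)) *\<^sub>R u) * complex_of_real (heat 1 u))
        \<longlonglongrightarrow> g x * complex_of_real (heat 1 u)"
    proof (rule AE_I2)
      fix u :: 'a
      have "(\<lambda>k. x + inverse (real (Suc k)) *\<^sub>R u) \<longlonglongrightarrow> x + 0 *\<^sub>R u"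
        by (intro tendsto_intros LIMSEQ_inverse_real_of_nat)
      then have "(\<lambda>k. g (x + inverse (real (Suc k)) *\<^sub>R u)) \<longlonglongrightarrow> g x"
        by (intro continuous_on_tendsto_compose[OF g]) auto
      then show "(\<lambda>k. g (x + inverse (real (Suc k)) *\<^sub>R u) * complex_of_real (heat 1 u))
        \<longlonglongrightarrow> g x * complex_of_real (heat 1 u)"
        by (intro tendsto_intros)
    qed
    show "AE u in lebesgue. norm (g (x + inverse (real (Suc k)) *\<^sub>R u) * complex_of_real (heat 1 u))
        \<le> b * heat 1 u" for k
      using bound by (auto simp: norm_mult intro!: mult_right_mono)
  qed (auto intro!: borel_imp_lebesgue_measurable)
  moreover have "(LINT u|lebesgue. g x * complex_of_real (heat 1 (u :: 'a))) = g x"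
    using heat_integral(2)[where 'a='a, of 1] by simp
  ultimately show ?thesis
    by (subst heat_average_rescale[OF g_meas]) auto
qed

text \<open>Let the Gaussian weight tend to \<open>1\<close> on both sides of its energy identity: the left side is
  dominated by \<open>|FT g|\<^sup>2\<close>, integrable by the inequality already known, and on the right the
  averages of \<open>g\<close> are bounded and converge pointwise to \<open>g\<close>.\<close>

lemma FT_isometry_continuous:
  fixes g :: "'a::euclidean_space \<Rightarrow> complex"
  assumes g: "continuous_on UNIV g" and bound: "\<And>x. cmod (g x) \<le> b"
    and gL2: "g \<in> L2_space" and gi: "integrable lebesgue g"
  shows "L2_norm (FT g) = plancherel_const TYPE('a) * L2_norm g"
proof -
  note F = FT_Bessel[OF gL2 gi]
  note [measurable] = L2_measurable[OF gL2] L2_measurable[OF F(1)] ident_lebesgue_borel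
  let ?C = "complex_of_real ((2 * pi) ^ DIM('a))"
  let ?w = "\<lambda>k \<xi>::'a. complex_of_real (exp (- (inverse (real (Suc k)) * norm \<xi>)\<^sup>2 / 2))"
  let ?H = "\<lambda>k x. LINT y|lebesgue. g y * complex_of_real (heat (inverse (real (Suc k))) (x - y))"
  have lhs: "(\<lambda>k. LINT \<xi>|lebesgue. FT g \<xi> * (cnj (FT g \<xi>) * ?w k \<xi>))
      \<longlonglongrightarrow> (LINT \<xi>|lebesgue. FT g \<xi> * (cnj (FT g \<xi>) * 1))"
  proof (rule integral_dominated_convergence[where w="\<lambda>\<xi>. (cmod (FT g \<xi>))\<^sup>2"])
    show "integrable lebesgue (\<lambda>\<xi>. (cmod (FT g \<xi>))\<^sup>2)"
      by (rule L2_integrable_sq[OF F(1)])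
    show "AE \<xi> in lebesgue. (\<lambda>k. FT g \<xi> * (cnj (FT g \<xi>) * ?w k \<xi>)) \<longlonglongrightarrow> FT g \<xi> * (cnj (FT g \<xi>) * 1)"
      by (intro AE_I2 tendsto_intros tendsto_of_real[OF gaussian_weight_tendsto, unfolded of_real_1])
    show "AE \<xi> in lebesgue. norm (FT g \<xi> * (cnj (FT g \<xi>) * ?w k \<xi>)) \<le> (cmod (FT g \<xi>))\<^sup>2" for k
      by (auto simp: norm_mult power2_eq_square mult.assoc[symmetric] intro!: mult_right_le_one_le)
    have w_meas: "?w k \<in> borel_measurable lebesgue" for k
      by (intro borel_imp_lebesgue_measurable) measurable
    show "(\<lambda>\<xi>. FT g \<xi> * (cnj (FT g \<xi>) * ?w k \<xi>)) \<in> borel_measurable lebesgue"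
      and "(\<lambda>\<xi>. FT g \<xi> * (cnj (FT g \<xi>) * 1)) \<in> borel_measurable lebesgue" for k
      by (intro borel_measurable_times L2_measurable[OF F(1)] L2_measurable[OF L2_cnj(1)[OF F(1)]]
          w_meas borel_measurable_const)+
  qed
  have rhs: "(\<lambda>k. LINT x|lebesgue. g x * cnj (?C * ?H k x)) \<longlonglongrightarrow> (LINT x|lebesgue. g x * cnj (?C * g x))"
  proof (rule integral_dominated_convergence[where w="\<lambda>x. cmod (g x) * ((2 * pi) ^ DIM('a) * b)"])
    show "integrable lebesgue (\<lambda>x. cmod (g x) * ((2 * pi) ^ DIM('a) * b))"
      by (intro integrable_mult_left integrable_norm gi)
    show "AE x in lebesgue. (\<lambda>k. g x * cnj (?C * ?H k x)) \<longlonglongrightarrow> g x * cnj (?C * g x)"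
      by (intro AE_I2 tendsto_intros heat_average_tendsto[OF g bound])
    show "AE x in lebesgue. norm (g x * cnj (?C * ?H k x)) \<le> cmod (g x) * ((2 * pi) ^ DIM('a) * b)" for k
    proof (rule AE_I2)
      fix x :: 'a
      have "cmod (?H k x) \<le> b"
        by (rule heat_average_bound[OF bound]) simp
      then show "norm (g x * cnj (?C * ?H k x)) \<le> cmod (g x) * ((2 * pi) ^ DIM('a) * b)"
        unfolding norm_mult complex_mod_cnj norm_of_real by (intro mult_mono mult_nonneg_nonneg) auto
    qed
    show "(\<lambda>x. g x * cnj (?C * ?H k x)) \<in> borel_measurable lebesgue" for k
    proof -
      have "?H k \<in> borel_measurable lebesgue"
        by (intro lebesgue.borel_measurable_lebesgue_integral) measurable
      then show ?thesis
        by (intro borel_measurable_times borel_measurable_cnj borel_measurable_const L2_measurable[OF gL2])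
    qed
    show "(\<lambda>x. g x * cnj (?C * g x)) \<in> borel_measurable lebesgue"
      by (intro borel_measurable_times borel_measurable_cnj borel_measurable_const L2_measurable[OF gL2])
  qed
  have "(LINT \<xi>|lebesgue. FT g \<xi> * (cnj (FT g \<xi>) * 1)) = (LINT x|lebesgue. g x * cnj (?C * g x))"
    by (rule LIMSEQ_unique[OF lhs]) (use rhs in \<open>simp only: FT_gaussian_weight[OF gi] inverse_positive_iff_positive of_nat_0_less_iff zero_less_Suc\<close>)
  moreover have "FT g \<xi> * (cnj (FT g \<xi>) * 1) = complex_of_real ((cmod (FT g \<xi>))\<^sup>2)" for \<xi>
    by (simp add: complex_norm_square[symmetric] del: of_real_power)
  moreover have "g x * cnj (?C * g x) = complex_of_real ((2 * pi) ^ DIM('a) * (cmod (g x))\<^sup>2)" for x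
    unfolding of_real_mult[of "(2 * pi) ^ DIM('a)"] complex_norm_square by simp
  ultimately have "complex_of_real ((L2_norm (FT g))\<^sup>2) = complex_of_real ((2 * pi) ^ DIM('a) * (L2_norm g)\<^sup>2)"
    by (simp only: integral_complex_of_real L2_norm_sq integral_mult_right_zero)
  then have "(L2_norm (FT g))\<^sup>2 = (plancherel_const TYPE('a) * L2_norm g)\<^sup>2"
    by (simp only: of_real_eq_iff power_mult_distrib plancherel_const_sq)
  then show ?thesis
    using plancherel_const_pos[where 'a='a] by (simp add: power2_eq_iff_nonneg)
qed

text \<open>The inequality already known makes the transform continuous in norm, so the equality passes
  from continuous compactly supported functions to their limits.\<close>

lemma FT_isometry:
  fixes f :: "'a::euclidean_space \<Rightarrow> complex"
  assumes f: "f \<in> L2_space" and fi: "integrable lebesgue f"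
  shows "L2_norm (FT f) = plancherel_const TYPE('a) * L2_norm f"
proof (rule antisym)
  let ?c = "plancherel_const TYPE('a)"
  show "L2_norm (FT f) \<le> ?c * L2_norm f"
    by (rule FT_Bessel(2)[OF f fi])
  show "?c * L2_norm f \<le> L2_norm (FT f)"
  proof (rule field_le_epsilon)
    fix e :: real assume "e > 0"
    then have "e / (2 * ?c) > 0"
      using plancherel_const_pos[where 'a='a] by simp
    then obtain g b r where g: "continuous_on UNIV g" "\<And>x. cmod (g x) \<le> b" "\<And>x. norm x > r \<Longrightarrow> g x = 0"
      "g \<in> L2_space" and fg: "L2_norm (\<lambda>x. f x - g x) < e / (2 * ?c)"
      by (rule L2_dense_continuous[OF f]) blast
    have "trunc r g = g"
      using g(3) by (force simp: trunc_def fun_eq_iff indicator_def)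
    then have gi: "integrable lebesgue g"
      using trunc_L2(2)[OF g(4), of r] by simp
    have diff: "(\<lambda>x. f x - g x) \<in> L2_space" "integrable lebesgue (\<lambda>x. f x - g x)"
      using f g(4) fi gi by (auto intro: L2_diff)
    have FT_eq: "FT (\<lambda>x. f x - g x) = (\<lambda>\<xi>. FT f \<xi> - FT g \<xi>)"
      using FT_diff[OF fi gi] by blast
    have "?c * L2_norm f \<le> ?c * (L2_norm (\<lambda>x. f x - g x) + L2_norm g)"
      using L2_triangle_diff[OF f g(4)] plancherel_const_pos[where 'a='a] by simp
    also have "\<dots> = ?c * L2_norm (\<lambda>x. f x - g x) + L2_norm (FT g)"
      using FT_isometry_continuous[OF g(1,2,4) gi] by (simp add: distrib_left)
    also have "L2_norm (FT g) \<le> L2_norm (\<lambda>\<xi>. FT g \<xi> - FT f \<xi>) + L2_norm (FT f)"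
      by (intro L2_triangle_diff FT_Bessel f fi g gi)
    also have "L2_norm (\<lambda>\<xi>. FT g \<xi> - FT f \<xi>) \<le> ?c * L2_norm (\<lambda>x. f x - g x)"
      using FT_Bessel(2)[OF diff] unfolding FT_eq by (subst L2_norm_minus_commute)
    also have "?c * L2_norm (\<lambda>x. f x - g x) + (?c * L2_norm (\<lambda>x. f x - g x) + L2_norm (FT f))
        \<le> L2_norm (FT f) + e"
      using fg plancherel_const_pos[where 'a='a] by (simp add: field_simps)
    finally show "?c * L2_norm f \<le> L2_norm (FT f) + e" by simp
  qed
qed

section \<open>The Fourier transform on square integrable functions\<close>

lemma is_L2_fourier_iff:
  fixes f :: "'a::euclidean_space \<Rightarrow> complex"
  assumes f: "f \<in> L2_space"
  shows "is_L2_fourier f F \<longleftrightarrow> F \<in> L2_space \<and>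
    ((\<lambda>r. L2_norm (\<lambda>\<xi>. FT (trunc r f) \<xi> - F \<xi>)) \<longlongrightarrow> 0) at_top"
proof -
  have eq: "(LINT x:cball 0 r|lebesgue. f x * exp (- (\<i> * complex_of_real (x \<bullet> \<xi>)))) = FT (trunc r f) \<xi>" for r \<xi>
    by (simp add: set_lebesgue_integral_def FT_def trunc_def)
  have "((\<lambda>r. \<integral>\<^sup>+\<xi>. ennreal ((cmod (FT (trunc r f) \<xi> - F \<xi>))\<^sup>2) \<partial>lebesgue) \<longlongrightarrow> 0) at_top
      \<longleftrightarrow> ((\<lambda>r. L2_norm (\<lambda>\<xi>. FT (trunc r f) \<xi> - F \<xi>)) \<longlongrightarrow> 0) at_top" if F: "F \<in> L2_space"
  proof -
    have "(\<lambda>\<xi>. FT (trunc r f) \<xi> - F \<xi>) \<in> L2_space" for r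
      by (intro L2_diff FT_Bessel trunc_L2 f F)
    then have "(\<integral>\<^sup>+\<xi>. ennreal ((cmod (FT (trunc r f) \<xi> - F \<xi>))\<^sup>2) \<partial>lebesgue)
        = ennreal ((L2_norm (\<lambda>\<xi>. FT (trunc r f) \<xi> - F \<xi>))\<^sup>2)" for r
      by (rule nn_integral_L2)
    moreover have "((\<lambda>r. ennreal ((L2_norm (\<lambda>\<xi>. FT (trunc r f) \<xi> - F \<xi>))\<^sup>2)) \<longlongrightarrow> ennreal 0) at_top
      \<longleftrightarrow> ((\<lambda>r. (L2_norm (\<lambda>\<xi>. FT (trunc r f) \<xi> - F \<xi>))\<^sup>2) \<longlongrightarrow> 0) at_top"
      by (rule tendsto_ennreal_iff) auto
    moreover have "((\<lambda>r. (L2_norm (\<lambda>\<xi>. FT (trunc r f) \<xi> - F \<xi>))\<^sup>2) \<longlongrightarrow> 0) at_top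
      \<longleftrightarrow> ((\<lambda>r. L2_norm (\<lambda>\<xi>. FT (trunc r f) \<xi> - F \<xi>)) \<longlongrightarrow> 0) at_top"
    proof
      assume "((\<lambda>r. (L2_norm (\<lambda>\<xi>. FT (trunc r f) \<xi> - F \<xi>))\<^sup>2) \<longlongrightarrow> 0) at_top"
      from tendsto_real_sqrt[OF this]
      show "((\<lambda>r. L2_norm (\<lambda>\<xi>. FT (trunc r f) \<xi> - F \<xi>)) \<longlongrightarrow> 0) at_top"
        by simp
    next
      assume "((\<lambda>r. L2_norm (\<lambda>\<xi>. FT (trunc r f) \<xi> - F \<xi>)) \<longlongrightarrow> 0) at_top"
      from tendsto_power[OF this, of 2]
      show "((\<lambda>r. (L2_norm (\<lambda>\<xi>. FT (trunc r f) \<xi> - F \<xi>))\<^sup>2) \<longlongrightarrow> 0) at_top"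
        by simp
    qed
    ultimately show ?thesis by simp
  qed
  then show ?thesis
    unfolding is_L2_fourier_def eq by blast
qed

text \<open>The transforms of the truncations form a Cauchy family, being at the same distances from each
  other, up to a constant, as the truncations themselves.\<close>

lemma L2_fourier_exists:
  fixes f :: "'a::euclidean_space \<Rightarrow> complex"
  assumes f: "f \<in> L2_space"
  shows "\<exists>F. is_L2_fourier f F"
proof -
  let ?c = "plancherel_const TYPE('a)"
  have c: "?c > 0" by (rule plancherel_const_pos)
  let ?u = "\<lambda>r. FT (trunc r f)"
  let ?\<delta> = "\<lambda>r. L2_norm (\<lambda>x. trunc r f x - f x)"
  note tr = trunc_L2[OF f]
  have u: "?u r \<in> L2_space" for r
    by (intro FT_Bessel tr)
  have dist: "L2_norm (\<lambda>\<xi>. ?u r \<xi> - ?u s \<xi>) \<le> ?c * (?\<delta> r + ?\<delta> s)" for r s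
  proof -
    have "(\<lambda>\<xi>. ?u r \<xi> - ?u s \<xi>) = FT (\<lambda>x. trunc r f x - trunc s f x)"
      using FT_diff[OF tr(2) tr(2)] by auto
    then have "L2_norm (\<lambda>\<xi>. ?u r \<xi> - ?u s \<xi>) = ?c * L2_norm (\<lambda>x. trunc r f x - trunc s f x)"
      by (simp only: FT_isometry L2_diff tr Bochner_Integration.integrable_diff)
    also have "L2_norm (\<lambda>x. trunc r f x - trunc s f x) \<le> ?\<delta> r + ?\<delta> s"
      using L2_triangle_mid[OF tr(1) f tr(1), of r s] L2_norm_minus_commute[of f "trunc s f"] by simp
    finally show ?thesis using c by simp
  qed
  have \<delta>: "(\<lambda>n. ?\<delta> (real n)) \<longlonglongrightarrow> 0"
    by (rule filterlim_compose[OF trunc_tendsto[OF f] filterlim_real_sequentially])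
  obtain F where F: "F \<in> L2_space" "(\<lambda>n. L2_norm (\<lambda>\<xi>. ?u (real n) \<xi> - F \<xi>)) \<longlonglongrightarrow> 0"
  proof (rule L2_complete[of "\<lambda>n. ?u (real n)"])
    fix e :: real assume "e > 0"
    then have "\<forall>\<^sub>F n in sequentially. ?\<delta> (real n) < e / (2 * ?c)"
      using order_tendstoD(2)[OF \<delta>, of "e / (2 * ?c)"] c by simp
    then obtain N where N: "\<And>n. n \<ge> N \<Longrightarrow> ?\<delta> (real n) < e / (2 * ?c)"
      by (auto simp: eventually_sequentially)
    have "L2_norm (\<lambda>\<xi>. ?u (real m) \<xi> - ?u (real n) \<xi>) < e" if "m \<ge> N" "n \<ge> N" for m n
    proof -
      have "?c * (?\<delta> (real m) + ?\<delta> (real n)) < ?c * (e / (2 * ?c) + e / (2 * ?c))"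
        using N[OF that(1)] N[OF that(2)] c by (intro mult_strict_left_mono add_strict_mono)
      also have "\<dots> = e" using c by simp
      finally show ?thesis using dist[of "real m" "real n"] by linarith
    qed
    then show "\<exists>N. \<forall>m\<ge>N. \<forall>n\<ge>N. L2_norm (\<lambda>\<xi>. ?u (real m) \<xi> - ?u (real n) \<xi>) < e"
      by blast
  qed (use u in auto)
  have close: "L2_norm (\<lambda>\<xi>. ?u r \<xi> - F \<xi>) \<le> ?c * ?\<delta> r" for r
  proof (rule LIMSEQ_le_const)
    show "(\<lambda>n. ?c * (?\<delta> r + ?\<delta> (real n)) + L2_norm (\<lambda>\<xi>. ?u (real n) \<xi> - F \<xi>)) \<longlonglongrightarrow> ?c * ?\<delta> r"
      using tendsto_add[OF tendsto_mult[OF tendsto_const tendsto_add[OF tendsto_const \<delta>]] F(2), of ?c "?\<delta> r"] by simp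
    have "L2_norm (\<lambda>\<xi>. ?u r \<xi> - F \<xi>) \<le> ?c * (?\<delta> r + ?\<delta> (real n)) + L2_norm (\<lambda>\<xi>. ?u (real n) \<xi> - F \<xi>)" for n
      using L2_triangle_mid[OF u u F(1), of r "real n"] dist[of r "real n"] by linarith
    then show "\<exists>N. \<forall>n\<ge>N. L2_norm (\<lambda>\<xi>. ?u r \<xi> - F \<xi>)
        \<le> ?c * (?\<delta> r + ?\<delta> (real n)) + L2_norm (\<lambda>\<xi>. ?u (real n) \<xi> - F \<xi>)"
      by blast
  qed
  have "((\<lambda>r. ?c * ?\<delta> r) \<longlongrightarrow> 0) at_top"
    using tendsto_mult[OF tendsto_const trunc_tendsto[OF f], of ?c] by simp
  then have "((\<lambda>r. L2_norm (\<lambda>\<xi>. ?u r \<xi> - F \<xi>)) \<longlongrightarrow> 0) at_top"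
  proof (rule Lim_null_comparison[rotated])
    show "\<forall>\<^sub>F r in at_top. norm (L2_norm (\<lambda>\<xi>. ?u r \<xi> - F \<xi>)) \<le> ?c * ?\<delta> r"
      by (rule always_eventually) (use close in simp)
  qed
  then show ?thesis
    using is_L2_fourier_iff[OF f] F(1) by blast
qed

lemma
  assumes "f \<in> L2_space"
  shows L2_fourier_L2: "L2_fourier f \<in> L2_space"
    and L2_fourier_limit: "((\<lambda>r. L2_norm (\<lambda>\<xi>. FT (trunc r f) \<xi> - L2_fourier f \<xi>)) \<longlongrightarrow> 0) at_top"
proof -
  have "is_L2_fourier f (L2_fourier f)"
    unfolding L2_fourier_def by (rule someI_ex[OF L2_fourier_exists[OF assms]])
  then show "L2_fourier f \<in> L2_space"
    and "((\<lambda>r. L2_norm (\<lambda>\<xi>. FT (trunc r f) \<xi> - L2_fourier f \<xi>)) \<longlongrightarrow> 0) at_top"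
    unfolding is_L2_fourier_iff[OF assms] by blast+
qed

lemma L2_norm_tendsto:
  assumes "\<And>r. u r \<in> L2_space" "F \<in> L2_space"
    and "((\<lambda>r. L2_norm (\<lambda>x. u r x - F x)) \<longlongrightarrow> 0) A"
  shows "((\<lambda>r. L2_norm (u r)) \<longlongrightarrow> L2_norm F) A"
proof (rule LIM_zero_cancel)
  have "norm (L2_norm (u r) - L2_norm F) \<le> L2_norm (\<lambda>x. u r x - F x)" for r
    using L2_norm_diff_le[OF assms(1,2)] by simp
  then have "\<forall>\<^sub>F r in A. norm (L2_norm (u r) - L2_norm F) \<le> L2_norm (\<lambda>x. u r x - F x)"
    by (intro always_eventually allI)
  then show "((\<lambda>r. L2_norm (u r) - L2_norm F) \<longlongrightarrow> 0) A"
    by (rule Lim_null_comparison[OF _ assms(3)])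
qed

theorem plancherel:
  fixes f :: "'a::euclidean_space \<Rightarrow> complex"
  assumes f: "f \<in> L2_space"
  shows "L2_norm (L2_fourier f) = plancherel_const TYPE('a) * L2_norm f"
proof (rule tendsto_unique)
  show "((\<lambda>r. L2_norm (FT (trunc r f))) \<longlongrightarrow> L2_norm (L2_fourier f)) at_top"
    by (intro L2_norm_tendsto L2_fourier_limit L2_fourier_L2 FT_Bessel trunc_L2 f)
  have "((\<lambda>r. L2_norm (trunc r f)) \<longlongrightarrow> L2_norm f) at_top"
    by (intro L2_norm_tendsto trunc_tendsto trunc_L2 f)
  then show "((\<lambda>r. L2_norm (FT (trunc r f))) \<longlongrightarrow> plancherel_const TYPE('a) * L2_norm f) at_top"
    by (simp only: FT_isometry trunc_L2 f) (intro tendsto_intros)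
qed simp

lemma L2_pairing_tendsto:
  assumes u: "\<And>r. u r \<in> L2_space" "f \<in> L2_space" "((\<lambda>r. L2_norm (\<lambda>x. u r x - f x)) \<longlongrightarrow> 0) A"
    and v: "\<And>r. v r \<in> L2_space" "g \<in> L2_space" "((\<lambda>r. L2_norm (\<lambda>x. v r x - g x)) \<longlongrightarrow> 0) A"
  shows "((\<lambda>r. LINT x|lebesgue. u r x * v r x) \<longlongrightarrow> (LINT x|lebesgue. f x * g x)) A"
proof -
  have bound: "cmod ((LINT x|lebesgue. u r x * v r x) - (LINT x|lebesgue. f x * g x))
      \<le> L2_norm (\<lambda>x. u r x - f x) * L2_norm (v r) + L2_norm f * L2_norm (\<lambda>x. v r x - g x)" for r
  proof -
    have "(LINT x|lebesgue. u r x * v r x) - (LINT x|lebesgue. f x * g x)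
        = (LINT x|lebesgue. (u r x - f x) * v r x) + (LINT x|lebesgue. f x * (v r x - g x))"
      by (simp only: left_diff_distrib right_diff_distrib L2_mult_integrable u v
          Bochner_Integration.integral_diff) simp
    then show ?thesis
      using norm_triangle_mono[OF L2_Cauchy_Schwarz[OF L2_diff[OF u(1,2)] v(1)] L2_Cauchy_Schwarz[OF u(2) L2_diff[OF v(1,2)]]]
      by simp
  qed
  have "((\<lambda>r. L2_norm (\<lambda>x. u r x - f x) * L2_norm (v r) + L2_norm f * L2_norm (\<lambda>x. v r x - g x)) \<longlongrightarrow> 0) A"
    using tendsto_add[OF tendsto_mult[OF u(3) L2_norm_tendsto[OF v]] tendsto_mult[OF tendsto_const v(3)], of "L2_norm f"]
    by simp
  then have "((\<lambda>r. (LINT x|lebesgue. u r x * v r x) - (LINT x|lebesgue. f x * g x)) \<longlongrightarrow> 0) A"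
    by (rule Lim_null_comparison[OF always_eventually[OF allI[OF bound]]])
  then show ?thesis by (rule LIM_zero_cancel)
qed

lemma L2_fourier_multiplication_formula:
  assumes f: "f \<in> L2_space" and g: "g \<in> L2_space"
  shows "(LINT \<xi>|lebesgue. L2_fourier f \<xi> * g \<xi>) = (LINT x|lebesgue. f x * L2_fourier g x)"
proof (rule tendsto_unique)
  show "((\<lambda>r. LINT \<xi>|lebesgue. FT (trunc r f) \<xi> * trunc r g \<xi>) \<longlongrightarrow> (LINT \<xi>|lebesgue. L2_fourier f \<xi> * g \<xi>)) at_top"
    by (intro L2_pairing_tendsto L2_fourier_limit L2_fourier_L2 FT_Bessel trunc_L2 trunc_tendsto f g)
  have "((\<lambda>r. LINT x|lebesgue. trunc r f x * FT (trunc r g) x) \<longlongrightarrow> (LINT x|lebesgue. f x * L2_fourier g x)) at_top"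
    by (intro L2_pairing_tendsto L2_fourier_limit L2_fourier_L2 FT_Bessel trunc_L2 trunc_tendsto f g)
  then show "((\<lambda>r. LINT \<xi>|lebesgue. FT (trunc r f) \<xi> * trunc r g \<xi>) \<longlongrightarrow> (LINT x|lebesgue. f x * L2_fourier g x)) at_top"
    by (simp only: FT_multiplication_formula trunc_L2 f g)
qed simp

text \<open>The multiplication formula makes \<open>F \<mapsto> cnj (L2_fourier (cnj F))\<close> the adjoint of the transform.
  Applied to \<open>F\<close> and divided by \<open>(2 \<pi>)^n\<close>, the adjoint gives a candidate \<open>h\<close>. With \<open>G\<close> the transform
  of \<open>h\<close>, Plancherel's identity gives \<open>\<parallel>G\<parallel> = \<parallel>F\<parallel>\<close>, and the multiplication formula gives
  \<open>\<langle>G, F\<rangle> = \<parallel>F\<parallel>\<^sup>2\<close>; hence \<open>\<parallel>G - F\<parallel>\<^sup>2 = \<parallel>F\<parallel>\<^sup>2 - 2 \<parallel>F\<parallel>\<^sup>2 + \<parallel>F\<parallel>\<^sup>2 = 0\<close>.\<close>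

theorem L2_fourier_surj:
  fixes F :: "'a::euclidean_space \<Rightarrow> complex"
  assumes F: "F \<in> L2_space"
  obtains h where "h \<in> L2_space" "AE \<xi> in lebesgue. L2_fourier h \<xi> = F \<xi>"
    "L2_norm F = plancherel_const TYPE('a) * L2_norm h"
proof -
  let ?c = "plancherel_const TYPE('a)"
  have c: "?c > 0" by (rule plancherel_const_pos)
  define K where "K = L2_fourier (\<lambda>x. cnj (F x))"
  define h where "h x = complex_of_real (1 / ?c\<^sup>2) * cnj (K x)" for x
  define G where "G = L2_fourier h"
  have cF: "(\<lambda>x. cnj (F x)) \<in> L2_space" by (rule L2_cnj(1)[OF F])
  have K: "K \<in> L2_space" "L2_norm K = ?c * L2_norm F"
    unfolding K_def using plancherel[OF cF] L2_fourier_L2[OF cF] L2_cnj(2)[OF F] by auto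
  have h: "h \<in> L2_space"
    unfolding h_def by (intro L2_cmult L2_cnj K)
  have h_norm: "?c * L2_norm h = L2_norm F"
  proof -
    have "L2_norm h = cmod (complex_of_real (1 / ?c\<^sup>2)) * L2_norm K"
      unfolding h_def by (simp only: L2_cmult(2)[OF L2_cnj(1)[OF K(1)]] L2_cnj(2)[OF K(1)])
    also have "cmod (complex_of_real (1 / ?c\<^sup>2)) = 1 / ?c\<^sup>2"
      unfolding norm_of_real by simp
    finally show ?thesis
      using c K(2) by (simp add: power2_eq_square)
  qed
  have G: "G \<in> L2_space" "L2_norm G = L2_norm F"
    unfolding G_def using plancherel[OF h] L2_fourier_L2[OF h] h_norm by auto
  have GF: "(LINT x|lebesgue. G x * cnj (F x)) = complex_of_real ((L2_norm F)\<^sup>2)"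
  proof -
    have "(LINT x|lebesgue. G x * cnj (F x)) = (LINT x|lebesgue. h x * K x)"
      unfolding G_def K_def by (rule L2_fourier_multiplication_formula[OF h cF])
    also have "(\<lambda>x. h x * K x) = (\<lambda>x. complex_of_real ((1 / ?c\<^sup>2) * (cmod (K x))\<^sup>2))"
    proof
      fix x
      show "h x * K x = complex_of_real ((1 / ?c\<^sup>2) * (cmod (K x))\<^sup>2)"
        unfolding h_def of_real_mult complex_norm_square by (simp add: mult_ac)
    qed
    also have "(LINT x|lebesgue. complex_of_real ((1 / ?c\<^sup>2) * (cmod (K x))\<^sup>2))
        = complex_of_real ((1 / ?c\<^sup>2) * (L2_norm K)\<^sup>2)"
      by (simp only: integral_complex_of_real L2_norm_sq integral_mult_right_zero)
    also have "(1 / ?c\<^sup>2) * (L2_norm K)\<^sup>2 = (L2_norm F)\<^sup>2"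
      using c K(2) by (simp add: power_mult_distrib)
    finally show ?thesis .
  qed
  have int: "integrable lebesgue (\<lambda>x. G x * cnj (F x))"
    by (rule L2_mult_integrable[OF G(1) cF])
  have "(\<lambda>x. (cmod (G x - F x))\<^sup>2) = (\<lambda>x. (cmod (G x))\<^sup>2 + (cmod (F x))\<^sup>2 - 2 * Re (G x * cnj (F x)))"
    by (auto simp: cmod_power2 power2_diff algebra_simps)
  then have "(L2_norm (\<lambda>x. G x - F x))\<^sup>2
      = (LINT x|lebesgue. (cmod (G x))\<^sup>2 + (cmod (F x))\<^sup>2 - 2 * Re (G x * cnj (F x)))"
    by (simp only: L2_norm_sq)
  also have "\<dots> = (L2_norm G)\<^sup>2 + (L2_norm F)\<^sup>2 - 2 * Re (LINT x|lebesgue. G x * cnj (F x))"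
    unfolding L2_norm_sq
    by (simp only: Bochner_Integration.integral_diff Bochner_Integration.integral_add
        Bochner_Integration.integrable_add integrable_mult_right integrable_Re[OF int]
        L2_integrable_sq G(1) F integral_mult_right_zero integral_Re[OF int])
  also have "\<dots> = 0"
    by (simp add: GF G(2))
  finally have "L2_norm (\<lambda>x. G x - F x) = 0" by simp
  from L2_norm_eq_0_AE[OF L2_diff[OF G(1) F] this]
  have "AE \<xi> in lebesgue. L2_fourier h \<xi> = F \<xi>"
    unfolding G_def by eventually_elim simp
  then show ?thesis
    by (rule that[OF h _ h_norm[symmetric]])
qed

section \<open>Mild solutions\<close>

text \<open>After squaring, this says that \<open>y^k / k!\<close> is at most \<open>exp y\<close> at \<open>y = a r\<^sup>2\<close>.\<close>

lemma power_mult_gaussian_bound: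
  assumes "a > 0" and "r \<ge> 0"
  shows "r ^ k * exp (- (a * r\<^sup>2) / 2) \<le> sqrt (fact k) / sqrt a ^ k"
proof (rule power2_le_imp_le)
  have "(a * r\<^sup>2) ^ k / fact k \<le> exp (a * r\<^sup>2)"
    using sum_le_suminf[OF summable_exp, of "{k}" "a * r\<^sup>2"] assms
    by (auto simp: exp_def divide_inverse mult_ac)
  then have "(a * r\<^sup>2) ^ k * exp (- (a * r\<^sup>2)) \<le> fact k"
    by (simp add: exp_minus field_simps)
  then have "(r\<^sup>2) ^ k * exp (- (a * r\<^sup>2)) \<le> fact k / a ^ k"
    using assms by (simp add: field_simps power_mult_distrib)
  moreover have "(r ^ k * exp (- (a * r\<^sup>2) / 2))\<^sup>2 = (r\<^sup>2) ^ k * exp (- (a * r\<^sup>2))"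
    by (simp add: power_mult_distrib exp_double[symmetric] power_mult[symmetric] mult.commute)
  moreover have "(sqrt a ^ k)\<^sup>2 = ((sqrt a)\<^sup>2) ^ k"
    by (simp only: power_mult[symmetric] mult.commute)
  then have "(sqrt (fact k) / sqrt a ^ k)\<^sup>2 = fact k / a ^ k"
    using assms by (simp add: power_divide)
  ultimately show "(r ^ k * exp (- (a * r\<^sup>2) / 2))\<^sup>2 \<le> (sqrt (fact k) / sqrt a ^ k)\<^sup>2"
    by simp
qed (use assms in auto)

text \<open>The factor \<open>sqrt (det M)\<close> is the one for which composition with \<open>M\<close> preserves the norm.\<close>

lemma L2_matrix_image_bound:
  fixes M :: "real^'n^'n"
  assumes det: "det M > 0" and G: "G \<in> L2_space" and F: "F \<in> borel_measurable lebesgue" and m: "m \<ge> 0"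
    and le: "AE \<xi> in lebesgue. cmod (F \<xi>) \<le> m * sqrt (det M) * cmod (G (M *v \<xi>))"
  shows "F \<in> L2_space" and "L2_norm F \<le> m * L2_norm G"
proof -
  note [measurable] = L2_measurable[OF G]
  let ?u = "\<lambda>\<xi>. ennreal ((cmod (G \<xi>))\<^sup>2)"
  have u: "?u \<in> borel_measurable lebesgue" by measurable
  have uM: "(\<lambda>\<xi>. ?u (M *v \<xi>)) \<in> borel_measurable lebesgue"
    using measurable_compose[OF matrix_measurable_lebesgue u, of M] det by simp
  have "(\<integral>\<^sup>+\<xi>. ennreal ((cmod (F \<xi>))\<^sup>2) \<partial>lebesgue) \<le> (\<integral>\<^sup>+\<xi>. ennreal (m\<^sup>2) * (ennreal (det M) * ?u (M *v \<xi>)) \<partial>lebesgue)"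
  proof (rule nn_integral_mono_AE)
    show "AE \<xi> in lebesgue. ennreal ((cmod (F \<xi>))\<^sup>2) \<le> ennreal (m\<^sup>2) * (ennreal (det M) * ?u (M *v \<xi>))"
      using le
    proof eventually_elim
      case (elim \<xi>)
      then have "(cmod (F \<xi>))\<^sup>2 \<le> (m * sqrt (det M) * cmod (G (M *v \<xi>)))\<^sup>2"
        by (intro power_mono) auto
      also have "\<dots> = m\<^sup>2 * (det M * (cmod (G (M *v \<xi>)))\<^sup>2)"
        using det by (simp add: power_mult_distrib)
      finally show ?case
        using det by (simp add: ennreal_mult[symmetric] ennreal_leI)
    qed
  qed
  also have "\<dots> = ennreal (m\<^sup>2) * (ennreal (det M) * (\<integral>\<^sup>+\<xi>. ?u (M *v \<xi>) \<partial>lebesgue))"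
    using uM by (simp add: nn_integral_cmult)
  also have "ennreal (det M) * (\<integral>\<^sup>+\<xi>. ?u (M *v \<xi>) \<partial>lebesgue) = ennreal ((L2_norm G)\<^sup>2)"
    using nn_integral_matrix_image[OF _ u, of M] det by (simp add: nn_integral_L2[OF G])
  also have "ennreal (m\<^sup>2) * ennreal ((L2_norm G)\<^sup>2) = ennreal ((m * L2_norm G)\<^sup>2)"
    by (simp add: ennreal_mult[symmetric] power_mult_distrib)
  finally show "F \<in> L2_space" "L2_norm F \<le> m * L2_norm G"
    using L2_I_nn_integral[OF F] m by auto
qed

text \<open>The integrand of the Gaussian exponent in the Fourier formula for the mild solution.\<close>

definition dissipation ::
  "(real \<Rightarrow> real^'n^'n) \<Rightarrow> real \<Rightarrow> (real \<Rightarrow> real \<Rightarrow> real^'n^'n) \<Rightarrow> real \<Rightarrow> real^'n \<Rightarrow> real \<Rightarrow> real" where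
  "dissipation A T R \<tau> \<xi> s = (norm (transpose (A (T - s)) *v (transpose (R \<tau> s) *v \<xi>)))\<^sup>2"

context
  fixes A B :: "real \<Rightarrow> real^'n^'n" and T :: real and R :: "real \<Rightarrow> real \<Rightarrow> real^'n^'n"
  assumes R: "is_resolvent B T R"
    and B: "continuous_on {0..T} (\<lambda>t. B (T - t))"
    and A: "continuous_on {0..T} (\<lambda>t. A (T - t))"
begin

lemma dissipation_integrable:
  assumes "0 \<le> a" "b \<le> T" "\<tau> \<in> {0..T}"
  shows "dissipation A T R \<tau> \<xi> integrable_on {a..b}"
proof -
  have "continuous_on {0..T} (\<lambda>t. transpose (A (T - t)))"
    unfolding transpose_def by (intro continuous_intros A)
  then have "continuous_on {0..T} (dissipation A T R \<tau> \<xi>)"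
    unfolding dissipation_def
    by (intro continuous_intros bounded_bilinear.continuous_on[OF bounded_bilinear_matrix_vector_mult]
        continuous_on_resolvent_transpose[OF R B assms(3)])
  then show ?thesis
    by (intro integrable_continuous_real) (rule continuous_on_subset, use assms in auto)
qed

lemma transpose_resolvent_cocycle:
  assumes "r \<in> {0..T}" "s \<in> {0..T}" "t \<in> {0..T}"
  shows "transpose (R r s) *v (transpose (R t r) *v \<xi>) = transpose (R t s) *v \<xi>"
  unfolding resolvent_cocycle[OF R B assms, symmetric] matrix_transpose_mul matrix_vector_mul_assoc ..

text \<open>This relates the exponent that occurs in the mild solution, with final time \<open>\<tau>\<close>, to the one
  that occurs in the admissibility condition and in the solution at the earlier time \<open>t\<close>.\<close>

lemma dissipation_shift:
  assumes "s \<in> {0..T}" "t \<in> {0..T}" "\<tau> \<in> {0..T}"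
  shows "dissipation A T R t (transpose (R \<tau> t) *v \<xi>) s = dissipation A T R \<tau> \<xi> s"
  unfolding dissipation_def transpose_resolvent_cocycle[OF assms(2,1,3)] ..

lemma det_transpose_resolvent:
  assumes "0 \<le> t" "t \<le> \<tau>" "\<tau> \<le> T"
  shows "det (transpose (R \<tau> t)) = exp (integral {t..\<tau>} (\<lambda>r. trace (B (T - r))))"
    and "sqrt (det (transpose (R \<tau> t))) = exp (1/2 * integral {t..\<tau>} (\<lambda>r. trace (B (T - r))))"
proof -
  show *: "det (transpose (R \<tau> t)) = exp (integral {t..\<tau>} (\<lambda>r. trace (B (T - r))))"
    using liouville[OF R B assms] by simp
  show "sqrt (det (transpose (R \<tau> t))) = exp (1/2 * integral {t..\<tau>} (\<lambda>r. trace (B (T - r))))"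
    unfolding * by (rule real_sqrt_unique) (simp_all add: exp_double[symmetric])
qed

context
  fixes g\<^sub>0 :: "real^'n \<Rightarrow> complex" and g :: "real \<Rightarrow> real^'n \<Rightarrow> complex"
  assumes g\<^sub>0: "g\<^sub>0 \<in> L2_space" and mild: "is_mild_solution A B T R g\<^sub>0 g"
begin

lemma mild_L2: "t \<in> {0..T} \<Longrightarrow> g t \<in> L2_space"
  using mild unfolding is_mild_solution_def continuous_into_L2_def by blast

lemma mild_fourier:
  assumes "0 \<le> t" "t \<le> T"
  shows "AE \<xi> in lebesgue. L2_fourier (g t) \<xi> =
     complex_of_real (sqrt (det (transpose (R t 0)))) * L2_fourier g\<^sub>0 (transpose (R t 0) *v \<xi>)
     * complex_of_real (exp (- (1/2) * integral {0..t} (dissipation A T R t \<xi>)))"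
proof -
  have "t \<in> {0..T}" using assms by simp
  then show ?thesis
    using mild unfolding is_mild_solution_def det_transpose_resolvent(2)[OF order.refl assms] dissipation_def[abs_def]
    by blast
qed

text \<open>At the point \<open>transpose (R \<tau> t) *v \<xi>\<close>, the Fourier formula at time \<open>t\<close> expresses the value of
  the transform of \<open>g\<^sub>0\<close> that occurs in the formula at time \<open>\<tau>\<close>. An identity that holds almost
  everywhere may be evaluated there because the matrix is invertible.\<close>

lemma mild_propagation:
  assumes "0 \<le> t" "t \<le> \<tau>" "\<tau> \<le> T"
  shows "AE \<xi> in lebesgue. L2_fourier (g \<tau>) \<xi> =
     complex_of_real (sqrt (det (transpose (R \<tau> t)))) * L2_fourier (g t) (transpose (R \<tau> t) *v \<xi>)
     * complex_of_real (exp (- (1/2) * integral {t..\<tau>} (dissipation A T R \<tau> \<xi>)))"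
proof -
  let ?M = "transpose (R \<tau> t)"
  have mem: "t \<in> {0..T}" "\<tau> \<in> {0..T}" "0 \<in> {0..T}" using assms by auto
  have det: "det ?M \<noteq> 0"
    unfolding det_transpose_resolvent(1)[OF assms] by simp
  have sqrt_det: "sqrt (det (transpose (R \<tau> 0))) = sqrt (det ?M) * sqrt (det (transpose (R t 0)))"
    unfolding resolvent_cocycle[OF R B mem(1,3,2), symmetric] real_sqrt_mult[symmetric]
    by (simp add: det_mul)
  have split: "integral {0..\<tau>} (dissipation A T R \<tau> \<xi>)
      = integral {0..t} (dissipation A T R t (?M *v \<xi>)) + integral {t..\<tau>} (dissipation A T R \<tau> \<xi>)" for \<xi>
  proof -
    have "integral {0..t} (dissipation A T R t (?M *v \<xi>)) = integral {0..t} (dissipation A T R \<tau> \<xi>)"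
      using assms by (intro Henstock_Kurzweil_Integration.integral_cong dissipation_shift) auto
    then show ?thesis
      using Henstock_Kurzweil_Integration.integral_combine[OF assms(1,2)
          dissipation_integrable[OF order.refl assms(3) mem(2)]]
      by simp
  qed
  have "t \<le> T" "0 \<le> \<tau>" using assms by auto
  show ?thesis
    using AE_matrix_image[OF det mild_fourier[OF assms(1) \<open>t \<le> T\<close>]] mild_fourier[OF \<open>0 \<le> \<tau>\<close> assms(3)]
  proof eventually_elim
    case (elim \<xi>)
    show ?case
      unfolding elim transpose_resolvent_cocycle[OF mem(1,3,2)] split sqrt_det
        distrib_left exp_add of_real_mult
      by (simp only: mult_ac)
  qed
qed

text \<open>The determinant factor is absorbed by the change of variables, and the Gaussian factor is at
  most one.\<close>

lemma mild_contraction: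
  assumes "0 \<le> t" "t \<le> T"
  shows "L2_norm (g t) \<le> L2_norm g\<^sub>0"
proof -
  have "L2_norm (L2_fourier (g t)) \<le> 1 * L2_norm (L2_fourier g\<^sub>0)"
  proof (rule L2_matrix_image_bound(2)[where M="transpose (R t 0)"])
    show "AE \<xi> in lebesgue. cmod (L2_fourier (g t) \<xi>)
      \<le> 1 * sqrt (det (transpose (R t 0))) * cmod (L2_fourier g\<^sub>0 (transpose (R t 0) *v \<xi>))"
      using mild_fourier[OF assms]
    proof eventually_elim
      case (elim \<xi>)
      have "0 \<le> integral {0..t} (dissipation A T R t \<xi>)"
        by (rule Henstock_Kurzweil_Integration.integral_nonneg)
           (use assms in \<open>auto intro!: dissipation_integrable simp: dissipation_def\<close>)
      then have "exp (- (1/2) * integral {0..t} (dissipation A T R t \<xi>)) \<le> 1"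
        by simp
      moreover have "0 \<le> det (transpose (R t 0))"
        unfolding det_transpose_resolvent(1)[OF order.refl assms] by simp
      ultimately show ?case
        unfolding elim norm_mult norm_of_real
        by (simp only: abs_of_nonneg real_sqrt_ge_zero exp_ge_zero mult_1)
           (intro mult_right_le_one_le mult_nonneg_nonneg, auto)
    qed
    show "0 < det (transpose (R t 0))"
      unfolding det_transpose_resolvent(1)[OF order.refl assms] by simp
    show "L2_fourier (g t) \<in> borel_measurable lebesgue"
      using assms by (intro L2_measurable L2_fourier_L2 mild_L2) auto
  qed (auto intro: L2_fourier_L2 g\<^sub>0)
  then show ?thesis
    using plancherel[OF g\<^sub>0] plancherel[OF mild_L2[of t]] assms plancherel_const_pos[where 'a="real^'n"]
    by simp
qed

text \<open>The Gaussian factor pays for \<open>|\<xi>|^k\<close>. The function \<open>h\<close> exists because the Fourier transform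
  is onto.\<close>

lemma mild_smoothing:
  assumes times: "0 \<le> t" "t \<le> \<tau>" "\<tau> \<le> T" and a: "a > 0"
    and lower: "\<And>\<xi>. a * (norm \<xi>)\<^sup>2 \<le> integral {t..\<tau>} (dissipation A T R \<tau> \<xi>)"
  shows "\<exists>h. is_abs_D_power k (g \<tau>) h \<and> L2_norm h \<le> sqrt (fact k) / sqrt a ^ k * L2_norm (g t)"
proof -
  let ?M = "transpose (R \<tau> t)" and ?m = "sqrt (fact k) / sqrt a ^ k"
  let ?c = "plancherel_const TYPE(real^'n)"
  define F where "F \<xi> = complex_of_real (norm \<xi> ^ k) * L2_fourier (g \<tau>) \<xi>" for \<xi>
  have g: "g t \<in> L2_space" "g \<tau> \<in> L2_space"
    using times by (auto intro!: mild_L2)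
  have det: "det ?M > 0"
    unfolding det_transpose_resolvent(1)[OF times] by simp
  have m: "?m \<ge> 0" using a by simp
  have F_meas: "F \<in> borel_measurable lebesgue"
  proof -
    have "(\<lambda>\<xi>::real^'n. complex_of_real (norm \<xi> ^ k)) \<in> borel_measurable lebesgue"
      by (intro borel_imp_lebesgue_measurable) measurable
    then show ?thesis
      unfolding F_def by (rule borel_measurable_times) (rule L2_measurable[OF L2_fourier_L2[OF g(2)]])
  qed
  have bound: "AE \<xi> in lebesgue. cmod (F \<xi>) \<le> ?m * sqrt (det ?M) * cmod (L2_fourier (g t) (?M *v \<xi>))"
    using mild_propagation[OF times]
  proof eventually_elim
    case (elim \<xi>)
    have "norm \<xi> ^ k * exp (- (1/2) * integral {t..\<tau>} (dissipation A T R \<tau> \<xi>))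
        \<le> norm \<xi> ^ k * exp (- (a * (norm \<xi>)\<^sup>2) / 2)"
      using lower[of \<xi>] by (intro mult_left_mono) auto
    also have "\<dots> \<le> ?m"
      by (rule power_mult_gaussian_bound[OF a norm_ge_zero])
    finally have "(norm \<xi> ^ k * exp (- (1/2) * integral {t..\<tau>} (dissipation A T R \<tau> \<xi>)))
        * (sqrt (det ?M) * cmod (L2_fourier (g t) (?M *v \<xi>)))
        \<le> ?m * (sqrt (det ?M) * cmod (L2_fourier (g t) (?M *v \<xi>)))"
      using det by (intro mult_right_mono) auto
    then show ?case
      unfolding F_def elim using det by (simp add: norm_mult norm_power mult_ac)
  qed
  note F = L2_matrix_image_bound[OF det L2_fourier_L2[OF g(1)] F_meas m bound]
  obtain h where h: "h \<in> L2_space" "AE \<xi> in lebesgue. L2_fourier h \<xi> = F \<xi>" "L2_norm F = ?c * L2_norm h"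
    by (rule L2_fourier_surj[OF F(1)])
  have "is_abs_D_power k (g \<tau>) h"
    using g(2) h(1,2) by (simp add: is_abs_D_power_def F_def)
  moreover have "?c * L2_norm h \<le> ?c * (?m * L2_norm (g t))"
    using F(2) h(3) plancherel[OF g(1)] by (simp add: mult_ac)
  then have "L2_norm h \<le> ?m * L2_norm (g t)"
    using plancherel_const_pos[where 'a="real^'n"] by (simp only: mult_le_cancel_left_pos)
  ultimately show ?thesis by blast
qed

end

text \<open>The hypothesis is used at \<open>\<eta> = transpose (R \<tau> t) *v \<xi>\<close>, and \<open>\<xi>\<close> is recovered from \<open>\<eta>\<close> by the
  bounded matrix \<open>transpose (R t \<tau>)\<close>.\<close>

lemma dissipation_lower_bound:
  assumes times: "0 \<le> t" "t \<le> \<tau>" "\<tau> \<le> T"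
    and C: "C > 0" "\<And>s t v. s \<in> {0..T} \<Longrightarrow> t \<in> {0..T} \<Longrightarrow> norm (transpose (R t s) *v v) \<le> C * norm v"
    and b: "b \<ge> 0" "\<And>\<eta>. integral {t..\<tau>} (dissipation A T R t \<eta>) \<ge> b * (norm \<eta>)\<^sup>2"
  shows "b / C\<^sup>2 * (norm \<xi>)\<^sup>2 \<le> integral {t..\<tau>} (dissipation A T R \<tau> \<xi>)"
proof -
  let ?\<eta> = "transpose (R \<tau> t) *v \<xi>"
  have mem: "t \<in> {0..T}" "\<tau> \<in> {0..T}" using times by auto
  have "\<xi> = transpose (R t \<tau>) *v ?\<eta>"
    unfolding transpose_resolvent_cocycle[OF mem(1,2,2)] using resolvent_diag[OF R B mem(2)] by simp
  then have "norm \<xi> \<le> C * norm ?\<eta>"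
    using C(2)[OF mem(2,1), of ?\<eta>] by simp
  then have "(norm \<xi>)\<^sup>2 \<le> (C * norm ?\<eta>)\<^sup>2"
    by (intro power_mono) auto
  then have "b / C\<^sup>2 * (norm \<xi>)\<^sup>2 \<le> b / C\<^sup>2 * (C * norm ?\<eta>)\<^sup>2"
    using b(1) by (intro mult_left_mono) auto
  also have "\<dots> = b * (norm ?\<eta>)\<^sup>2"
    using C(1) by (simp add: power_mult_distrib)
  also have "\<dots> \<le> integral {t..\<tau>} (dissipation A T R t ?\<eta>)"
    by (rule b(2))
  also have "\<dots> = integral {t..\<tau>} (dissipation A T R \<tau> \<xi>)"
    using times by (intro Henstock_Kurzweil_Integration.integral_cong dissipation_shift) auto
  finally show ?thesis .
qed

end

lemma smooth_on_continuous_reflected: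
  assumes "is_interval I" "0 \<in> I" "T \<in> I" "smooth_on I f"
  shows "continuous_on {0..T} (\<lambda>t. f (T - t))"
proof -
  have "f differentiable (at t)" if "t \<in> I" for t
    using assms(4) that unfolding smooth_on_def by (auto dest!: spec[of _ "0::nat"])
  then have cont: "continuous_on I f"
    by (meson continuous_at_imp_continuous_on differentiable_imp_continuous_within)
  have sub: "T - t \<in> I" if "t \<in> {0..T}" for t
    using mem_is_interval_1_I[OF assms(1-3), of "T - t"] that by auto
  show ?thesis
    by (rule continuous_on_compose2[OF cont]) (intro continuous_intros, use sub in blast)
qed

theorem corollary2p3:
  fixes I :: "real set"
    and A B :: "real \<Rightarrow> real^'n^'n"
    and R :: "real \<Rightarrow> real \<Rightarrow> real^'n^'n"
    and T \<epsilon> \<epsilon>' :: real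
  assumes "open I" and "is_interval I" and "0 \<in> I"
    and "smooth_on I A" and "smooth_on I B"
    and "T > 0" and "T \<in> I"
    and "span {A_tilde A B k T *v x | k x. True} = UNIV"
    and "is_resolvent B T R"
    and "admissible_pair A B T R \<epsilon> \<epsilon>'"
  shows "\<exists>c\<^sub>0>0. \<forall>g\<^sub>0\<in>L2_space. \<forall>g. is_mild_solution A B T R g\<^sub>0 g \<longrightarrow>
    (\<forall>t \<tau>. \<epsilon> / 2 \<le> t \<and> t < \<tau> \<and> \<tau> \<le> \<epsilon> / 2 + \<epsilon>' \<longrightarrow>
      (\<forall>k::nat. \<exists>h. is_abs_D_power k (g \<tau>) h \<and>
        L2_norm h
          \<le> c\<^sub>0 ^ k / (\<tau> - t) powr ((2 * real CARD('n) - 1) * real k / 2)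
              * sqrt (fact k) * L2_norm (g t) \<and>
        c\<^sub>0 ^ k / (\<tau> - t) powr ((2 * real CARD('n) - 1) * real k / 2)
              * sqrt (fact k) * L2_norm (g t)
          \<le> c\<^sub>0 ^ k / (\<tau> - t) powr ((2 * real CARD('n) - 1) * real k / 2)
              * sqrt (fact k) * L2_norm g\<^sub>0))"
proof -
  note R = assms(9)
  have A: "continuous_on {0..T} (\<lambda>t. A (T - t))" and B: "continuous_on {0..T} (\<lambda>t. B (T - t))"
    using assms by (auto intro: smooth_on_continuous_reflected)
  obtain c where c: "c > 0" and adm: "0 < \<epsilon>" "\<epsilon> < T" "\<epsilon>' \<le> \<epsilon> / 2"
    and obs: "\<And>t \<tau> \<xi>. \<epsilon> / 2 \<le> t \<Longrightarrow> t \<le> \<tau> \<Longrightarrow> \<tau> \<le> \<epsilon> / 2 + \<epsilon>' \<Longrightarrow>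
      integral {t..\<tau>} (dissipation A T R t \<xi>) \<ge> c * (\<tau> - t) ^ (2 * CARD('n) - 1) * (norm \<xi>)\<^sup>2"
    using assms(10) unfolding admissible_pair_def dissipation_def[abs_def] by blast
  obtain C where C: "C > 0"
    "\<And>s t v. s \<in> {0..T} \<Longrightarrow> t \<in> {0..T} \<Longrightarrow> norm (transpose (R t s) *v v) \<le> C * norm v"
    using resolvent_transpose_bound[OF R B] by blast
  \<comment> \<open>The rate of the Gaussian is \<open>a = c (\<tau> - t)^N / C\<^sup>2\<close>, so \<open>1 / sqrt a\<close> is \<open>?c0\<close> divided by
    \<open>(\<tau> - t)^(N/2)\<close>.\<close>
  let ?c0 = "C / sqrt c"
  show ?thesis
  proof (intro exI[of _ ?c0] conjI ballI allI impI)
    show "0 < ?c0" using c C(1) by simp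
    fix g\<^sub>0 g t \<tau> k
    assume g\<^sub>0: "g\<^sub>0 \<in> L2_space" and mild: "is_mild_solution A B T R g\<^sub>0 g"
      and t\<tau>: "\<epsilon> / 2 \<le> t \<and> t < \<tau> \<and> \<tau> \<le> \<epsilon> / 2 + \<epsilon>'"
    have times: "0 \<le> t" "t \<le> \<tau>" "\<tau> \<le> T" "t \<le> T"
      using t\<tau> adm by auto
    define N where "N = 2 * CARD('n) - 1"
    have N: "real N = 2 * real CARD('n) - 1"
      unfolding N_def using zero_less_card_finite[where 'a='n] by (simp add: of_nat_diff)
    define a where "a = c * (\<tau> - t) ^ N / C\<^sup>2"
    have a: "a > 0" using c C(1) t\<tau> by (simp add: a_def)
    have lower: "a * (norm \<xi>)\<^sup>2 \<le> integral {t..\<tau>} (dissipation A T R \<tau> \<xi>)" for \<xi>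
      unfolding a_def
      by (rule dissipation_lower_bound[OF R B A times(1-3) C])
         (use obs[of t \<tau>] t\<tau> c in \<open>auto simp: N_def\<close>)
    have const: "sqrt (fact k) / sqrt a ^ k
        = ?c0 ^ k / (\<tau> - t) powr ((2 * real CARD('n) - 1) * real k / 2) * sqrt (fact k)"
    proof -
      have "sqrt ((\<tau> - t) ^ N) = (\<tau> - t) powr (real N / 2)"
        using t\<tau> by (simp add: powr_half_sqrt[symmetric] powr_realpow[symmetric] powr_powr)
      then have "sqrt a = sqrt c * (\<tau> - t) powr (real N / 2) / C"
        using C(1) by (simp add: a_def real_sqrt_mult real_sqrt_divide)
      moreover have "((\<tau> - t) powr (real N / 2)) ^ k = (\<tau> - t) powr (real N * real k / 2)"
        using t\<tau> by (simp add: powr_realpow[symmetric] powr_powr)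
      ultimately show ?thesis
        by (simp add: N[symmetric] power_mult_distrib power_divide)
    qed
    have nonneg: "0 \<le> sqrt (fact k) / sqrt a ^ k" using a by simp
    show "\<exists>h. is_abs_D_power k (g \<tau>) h \<and>
        L2_norm h
          \<le> ?c0 ^ k / (\<tau> - t) powr ((2 * real CARD('n) - 1) * real k / 2)
              * sqrt (fact k) * L2_norm (g t) \<and>
        ?c0 ^ k / (\<tau> - t) powr ((2 * real CARD('n) - 1) * real k / 2)
              * sqrt (fact k) * L2_norm (g t)
          \<le> ?c0 ^ k / (\<tau> - t) powr ((2 * real CARD('n) - 1) * real k / 2)
              * sqrt (fact k) * L2_norm g\<^sub>0"
      unfolding const[symmetric]
      using mild_smoothing[OF R B A g\<^sub>0 mild times(1-3) a lower, of k]
        mult_left_mono[OF mild_contraction[OF R B A g\<^sub>0 mild times(1,4)] nonneg]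
      by blast
  qed
qed

end
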